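(* Let $p\in\Sigma$. If there exists a unit vector $v\in T_p\Sigma$ such that $|h(v,v)|>|\bar A(v,v)|$, then no isometric extension of $f$ of class $C^1$ to a neighborhood of $p$ can exist; that is, for every neighborhood $U\subset M$ of $p$ there is no $u\in C^1(U,\mathbb{R}^q)$ with $u^*g_0=g$ on $U$ and $u|_{\Sigma\cap U}=f|_{\Sigma\cap U}$.
   Context: $(M,g)$ is a smooth $n$-dimensional Riemannian manifold, $n\geqslant 2$, $\Sigma\subset M$ is a smooth hypersurface (codimension one submanifold) with the induced metric, $q\geqslant n+1$, $g_0=\langle\cdot,\cdot\rangle$ is the Euclidean metric on $\mathbb{R}^q$, and $f:\Sigma\to\mathbb{R}^q$ is a smooth isometric immersion. $A\in\Gamma(\mathrm{S}^2(T^*\Sigma)\otimes N\Sigma)$ is the second fundamental form of $\Sigma$ in $M$, and $h(X,Y)=g(\nu,A(X,Y))$, where $\nu$ is a unit normal vector field of $\Sigma$ in $M$ ($|h(v,v)|$ does not depend on the choice of sign of $\nu$). $\bar A\in\Gamma(\mathrm{S}^2(T^*\Sigma)\otimes f^*N\bar\Sigma)$ is the second fundamental form of $\bar\Sigma=f(\Sigma)$ in $\mathbb{R}^q$, pulled back to $\Sigma$ via $f$ (i.e. the second fundamental form of the immersion $f$), and $|\bar A(v,v)|$ is its Euclidean norm. *)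

theory Defs
  imports "HOL-Analysis.Analysis"
begin

section \<open>Differentiability classes on open sets\<close>

text \<open>Only meaningful for open \<open>S\<close>. On finite-dimensional spaces, continuity of all iterated
  directional derivatives up to order \<open>k\<close> is the usual notion of class \<open>C\<^sup>k\<close>.\<close>

primrec Ck_on :: "nat \<Rightarrow> ('v::real_normed_vector \<Rightarrow> 'w::real_normed_vector) \<Rightarrow> 'v set \<Rightarrow> bool" where
  "Ck_on 0 f S \<longleftrightarrow> continuous_on S f"
| "Ck_on (Suc k) f S \<longleftrightarrow> (\<forall>x\<in>S. f differentiable (at x)) \<and>
     (\<forall>v. Ck_on k (\<lambda>x. frechet_derivative f (at x) v) S)"

definition smooth_on :: "('v::real_normed_vector \<Rightarrow> 'w::real_normed_vector) \<Rightarrow> 'v set \<Rightarrow> bool" where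
  "smooth_on f S \<longleftrightarrow> (\<forall>k. Ck_on k f S)"

section \<open>Smooth manifolds\<close>

type_synonym ('a, 'n) chart = "'a set \<times> ('a \<Rightarrow> (real, 'n) vec)"

record ('a, 'n) mfd =
  mtop :: "'a topology"
  atlas :: "('a, 'n) chart set"

abbreviation pts :: "('a, 'n) mfd \<Rightarrow> 'a set" where
  "pts M \<equiv> topspace (mtop M)"

definition chart_inv :: "('a, 'n) chart \<Rightarrow> (real, 'n) vec \<Rightarrow> 'a" where
  "chart_inv \<phi> = inv_into (fst \<phi>) (snd \<phi>)"

definition is_chart :: "'a topology \<Rightarrow> ('a, 'n::finite) chart \<Rightarrow> bool" where
  "is_chart X \<phi> \<longleftrightarrow> openin X (fst \<phi>) \<and> open (snd \<phi> ` fst \<phi>) \<and>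
     homeomorphic_map (subtopology X (fst \<phi>)) (top_of_set (snd \<phi> ` fst \<phi>)) (snd \<phi>)"

text \<open>The dimension is \<open>CARD('n)\<close>. The atlas need not be maximal.\<close>

definition smooth_manifold :: "('a, 'n::finite) mfd \<Rightarrow> bool" where
  "smooth_manifold M \<longleftrightarrow>
     Hausdorff_space (mtop M) \<and> second_countable (mtop M) \<and>
     (\<forall>\<phi>\<in>atlas M. is_chart (mtop M) \<phi>) \<and>
     pts M = (\<Union>\<phi>\<in>atlas M. fst \<phi>) \<and>
     (\<forall>\<phi>\<in>atlas M. \<forall>\<psi>\<in>atlas M.
        smooth_on (snd \<psi> \<circ> chart_inv \<phi>) (snd \<phi> ` (fst \<phi> \<inter> fst \<psi>)))"

definition charts_at :: "('a, 'n) mfd \<Rightarrow> 'a \<Rightarrow> ('a, 'n) chart set" where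
  "charts_at M p = {\<phi>\<in>atlas M. p \<in> fst \<phi>}"

text \<open>An arbitrary chart around \<open>p\<close>. Whatever is computed below in this chart is independent of
  the choice.\<close>

definition chart_at :: "('a, 'n) mfd \<Rightarrow> 'a \<Rightarrow> ('a, 'n) chart" where
  "chart_at M p = (SOME \<phi>. \<phi> \<in> charts_at M p)"

section \<open>Tangent vectors, maps and their differentials\<close>

text \<open>A tangent vector at \<open>p\<close> is the family of its component vectors in all charts around \<open>p\<close>,
  related by the differentials of the transition maps. The value 0 at the other charts makes
  the family unique; vector space operations are pointwise.\<close>

type_synonym ('a, 'n) tvec = "('a, 'n) chart \<Rightarrow> (real, 'n) vec"

definition tangent_space :: "('a, 'n::finite) mfd \<Rightarrow> 'a \<Rightarrow> ('a, 'n) tvec set" where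
  "tangent_space M p = {\<xi>.
     (\<forall>\<phi>\<in>charts_at M p. \<forall>\<psi>\<in>charts_at M p.
        \<xi> \<psi> = frechet_derivative (snd \<psi> \<circ> chart_inv \<phi>) (at (snd \<phi> p)) (\<xi> \<phi>)) \<and>
     (\<forall>\<phi>. \<phi> \<notin> charts_at M p \<longrightarrow> \<xi> \<phi> = 0)}"

text \<open>The tangent vector at \<open>p\<close> whose components in the chart \<open>\<phi>\<close> around \<open>p\<close> are \<open>a\<close>.\<close>

definition tvec_of :: "('a, 'n::finite) mfd \<Rightarrow> 'a \<Rightarrow> ('a, 'n) chart \<Rightarrow> real^'n \<Rightarrow> ('a, 'n) tvec" where
  "tvec_of M p \<phi> a = (\<lambda>\<psi>. if \<psi> \<in> charts_at M p
     then frechet_derivative (snd \<psi> \<circ> chart_inv \<phi>) (at (snd \<phi> p)) a else 0)"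

definition Ck_map_on :: "nat \<Rightarrow> ('a, 'm::finite) mfd \<Rightarrow> ('b, 'n::finite) mfd \<Rightarrow> 'a set \<Rightarrow> ('a \<Rightarrow> 'b) \<Rightarrow> bool" where
  "Ck_map_on k S M U F \<longleftrightarrow>
     openin (mtop S) U \<and> continuous_map (subtopology (mtop S) U) (mtop M) F \<and>
     (\<forall>\<psi>\<in>atlas S. \<forall>\<phi>\<in>atlas M.
        Ck_on k (snd \<phi> \<circ> F \<circ> chart_inv \<psi>) (snd \<psi> ` (fst \<psi> \<inter> U \<inter> F -` fst \<phi>)))"

definition smooth_map :: "('a, 'm::finite) mfd \<Rightarrow> ('b, 'n::finite) mfd \<Rightarrow> ('a \<Rightarrow> 'b) \<Rightarrow> bool" where
  "smooth_map S M F \<longleftrightarrow> (\<forall>k. Ck_map_on k S M (pts S) F)"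

definition differential ::
    "('a, 'm::finite) mfd \<Rightarrow> ('b, 'n::finite) mfd \<Rightarrow> ('a \<Rightarrow> 'b) \<Rightarrow> 'a \<Rightarrow> ('a, 'm) tvec \<Rightarrow> ('b, 'n) tvec" where
  "differential S M F p v = (let \<psi> = chart_at S p in
     (\<lambda>\<phi>. if \<phi> \<in> charts_at M (F p)
       then frechet_derivative (snd \<phi> \<circ> F \<circ> chart_inv \<psi>) (at (snd \<psi> p)) (v \<psi>) else 0))"

definition smooth_immersion :: "('a, 'm::finite) mfd \<Rightarrow> ('b, 'n::finite) mfd \<Rightarrow> ('a \<Rightarrow> 'b) \<Rightarrow> bool" where
  "smooth_immersion S M F \<longleftrightarrow> smooth_map S M F \<and>
     (\<forall>p\<in>pts S. inj_on (differential S M F p) (tangent_space S p))"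

text \<open>Embedded codimension-one submanifold: the manifold \<open>S\<close> lives on a subset of \<open>M\<close>, carries
  the subspace topology, and its inclusion into \<open>M\<close> is an immersion.\<close>

definition smooth_hypersurface :: "('a, 'n::finite) mfd \<Rightarrow> ('a, 'm::finite) mfd \<Rightarrow> bool" where
  "smooth_hypersurface M S \<longleftrightarrow>
     smooth_manifold S \<and> CARD('n) = CARD('m) + 1 \<and>
     pts S \<subseteq> pts M \<and> mtop S = subtopology (mtop M) (pts S) \<and>
     smooth_immersion S M id"

section \<open>Riemannian metrics\<close>

type_synonym ('a, 'n) metric_field = "'a \<Rightarrow> ('a, 'n) tvec \<Rightarrow> ('a, 'n) tvec \<Rightarrow> real"

text \<open>The coefficients of \<open>g\<close> in the chart \<open>\<phi>\<close>, as a bilinear form on the model space that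
  depends on the point \<open>x\<close> of the chart image.\<close>

definition local_metric ::
    "('a, 'n::finite) mfd \<Rightarrow> ('a, 'n) metric_field \<Rightarrow> ('a, 'n) chart \<Rightarrow> real^'n \<Rightarrow> real^'n \<Rightarrow> real^'n \<Rightarrow> real" where
  "local_metric M g \<phi> x a b =
     (let q = chart_inv \<phi> x in g q (tvec_of M q \<phi> a) (tvec_of M q \<phi> b))"

definition riemannian_metric :: "('a, 'n::finite) mfd \<Rightarrow> ('a, 'n) metric_field \<Rightarrow> bool" where
  "riemannian_metric M g \<longleftrightarrow>
     (\<forall>p\<in>pts M. \<forall>\<xi>\<in>tangent_space M p. \<forall>\<eta>\<in>tangent_space M p.
        g p \<xi> \<eta> = g p \<eta> \<xi> \<and>
        (\<forall>\<zeta>\<in>tangent_space M p. \<forall>a b.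
           g p (\<lambda>\<phi>. a *\<^sub>R \<xi> \<phi> + b *\<^sub>R \<eta> \<phi>) \<zeta> = a * g p \<xi> \<zeta> + b * g p \<eta> \<zeta>) \<and>
        (\<xi> \<noteq> (\<lambda>_. 0) \<longrightarrow> g p \<xi> \<xi> > 0)) \<and>
     (\<forall>\<phi>\<in>atlas M. \<forall>a b. smooth_on (\<lambda>x. local_metric M g \<phi> x a b) (snd \<phi> ` fst \<phi>))"

definition pullback_metric ::
    "('a, 'm::finite) mfd \<Rightarrow> ('b, 'n::finite) mfd \<Rightarrow> ('b, 'n) metric_field \<Rightarrow> ('a \<Rightarrow> 'b) \<Rightarrow> ('a, 'm) metric_field" where
  "pullback_metric S M g F p v w = g (F p) (differential S M F p v) (differential S M F p w)"

definition isometric_on ::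
    "('a, 'm::finite) mfd \<Rightarrow> ('a, 'm) metric_field \<Rightarrow> ('b, 'n::finite) mfd \<Rightarrow> ('b, 'n) metric_field
     \<Rightarrow> 'a set \<Rightarrow> ('a \<Rightarrow> 'b) \<Rightarrow> bool" where
  "isometric_on S h M g U F \<longleftrightarrow>
     (\<forall>p\<in>U. \<forall>v\<in>tangent_space S p. \<forall>w\<in>tangent_space S p. pullback_metric S M g F p v w = h p v w)"

definition euclidean_mfd :: "(real^'q, 'q::finite) mfd" where
  "euclidean_mfd = \<lparr>mtop = euclidean, atlas = {(UNIV, id)}\<rparr>"

definition flat_metric :: "(real^'q, 'q::finite) metric_field" where
  "flat_metric p \<xi> \<eta> = \<xi> (UNIV, id) \<bullet> \<eta> (UNIV, id)"

section \<open>The second fundamental form of an immersion\<close>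

text \<open>Coefficients of the Levi-Civita connection in a chart: \<open>\<Gamma> a b\<close> is \<open>\<nabla>\<^sub>a b\<close> for
  coordinate-constant vector fields \<open>a\<close>, \<open>b\<close>. As such fields commute, symmetry of \<open>\<Gamma>\<close> is
  vanishing torsion; the last clause is compatibility with the metric.\<close>

definition levi_civita ::
    "('a, 'n::finite) mfd \<Rightarrow> ('a, 'n) metric_field \<Rightarrow> ('a, 'n) chart \<Rightarrow> real^'n \<Rightarrow> real^'n \<Rightarrow> real^'n \<Rightarrow> real^'n" where
  "levi_civita M g \<phi> x = (THE \<Gamma>. bilinear \<Gamma> \<and> (\<forall>a b. \<Gamma> a b = \<Gamma> b a) \<and>
     (\<forall>a b c. frechet_derivative (\<lambda>y. local_metric M g \<phi> y a b) (at x) c =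
        local_metric M g \<phi> x (\<Gamma> c a) b + local_metric M g \<phi> x a (\<Gamma> c b)))"

text \<open>The covariant derivative, at \<open>p\<close> in direction \<open>v\<close>, of a vector field \<open>Y\<close> along
  \<open>F : S \<rightarrow> M\<close>, that is, \<open>Y x\<close> is a tangent vector of \<open>M\<close> at \<open>F x\<close>.\<close>

definition cov_deriv_along ::
    "('a, 'm::finite) mfd \<Rightarrow> ('b, 'n::finite) mfd \<Rightarrow> ('b, 'n) metric_field \<Rightarrow> ('a \<Rightarrow> 'b) \<Rightarrow>
     'a \<Rightarrow> ('a, 'm) tvec \<Rightarrow> ('a \<Rightarrow> ('b, 'n) tvec) \<Rightarrow> ('b, 'n) tvec" where
  "cov_deriv_along S M g F p v Y = (let \<psi> = chart_at S p; \<phi> = chart_at M (F p) in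
     tvec_of M (F p) \<phi>
       (frechet_derivative (\<lambda>x. Y (chart_inv \<psi> x) \<phi>) (at (snd \<psi> p)) (v \<psi>) +
        levi_civita M g \<phi> (snd \<phi> (F p)) (differential S M F p v \<phi>) (Y p \<phi>)))"

definition normal_part ::
    "('a, 'm::finite) mfd \<Rightarrow> ('b, 'n::finite) mfd \<Rightarrow> ('b, 'n) metric_field \<Rightarrow> ('a \<Rightarrow> 'b) \<Rightarrow>
     'a \<Rightarrow> ('b, 'n) tvec \<Rightarrow> ('b, 'n) tvec" where
  "normal_part S M g F p \<xi> = (THE \<eta>. \<eta> \<in> tangent_space M (F p) \<and>
     (\<forall>w\<in>tangent_space S p. g (F p) \<eta> (differential S M F p w) = 0) \<and>
     (\<exists>w\<in>tangent_space S p. \<xi> = (\<lambda>\<phi>. \<eta> \<phi> + differential S M F p w \<phi>)))"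

text \<open>\<open>(\<nabla>\<^sub>v (dF W))\<^sup>\<bottom>\<close> for a local vector field \<open>W\<close> on \<open>S\<close> with value \<open>w\<close> at \<open>p\<close>. The result does
  not depend on the extension \<open>W\<close>; we take the one with constant components in a chart. The
  induced metric of \<open>S\<close> does not enter.\<close>

definition second_fundamental_form ::
    "('a, 'm::finite) mfd \<Rightarrow> ('b, 'n::finite) mfd \<Rightarrow> ('b, 'n) metric_field \<Rightarrow> ('a \<Rightarrow> 'b) \<Rightarrow>
     'a \<Rightarrow> ('a, 'm) tvec \<Rightarrow> ('a, 'm) tvec \<Rightarrow> ('b, 'n) tvec" where
  "second_fundamental_form S M g F p v w = (let \<psi> = chart_at S p; W = (\<lambda>x. tvec_of S x \<psi> (w \<psi>)) in
     normal_part S M g F p (cov_deriv_along S M g F p v (\<lambda>x. differential S M F x (W x))))"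

definition unit_normal ::
    "('a, 'n::finite) mfd \<Rightarrow> ('a, 'n) metric_field \<Rightarrow> ('a, 'm::finite) mfd \<Rightarrow> 'a \<Rightarrow> ('a, 'n) tvec \<Rightarrow> bool" where
  "unit_normal M g S p \<nu> \<longleftrightarrow> \<nu> \<in> tangent_space M p \<and> g p \<nu> \<nu> = 1 \<and>
     (\<forall>v\<in>tangent_space S p. g p \<nu> (differential S M id p v) = 0)"

definition scalar_second_form ::
    "('a, 'n::finite) mfd \<Rightarrow> ('a, 'n) metric_field \<Rightarrow> ('a, 'm::finite) mfd \<Rightarrow> 'a \<Rightarrow> ('a, 'n) tvec \<Rightarrow>
     ('a, 'm) tvec \<Rightarrow> ('a, 'm) tvec \<Rightarrow> real" where
  "scalar_second_form M g S p \<nu> v w = g p \<nu> (second_fundamental_form S M g id p v w)"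

definition metric_norm :: "('a, 'n) metric_field \<Rightarrow> 'a \<Rightarrow> ('a, 'n) tvec \<Rightarrow> real" where
  "metric_norm g p \<xi> = sqrt (g p \<xi> \<xi>)"

end

theory Submission
  imports Defs
begin

text \<open>
Suppose a \<open>C\<^sup>1\<close> isometric extension \<open>u\<close> existed. If \<open>u\<close> were \<open>C\<^sup>2\<close>, differentiating
\<open>u\<^sup>*g\<^sub>0 = g\<close> would show that \<open>du\<close> carries the covariant acceleration \<open>\<nabla>\<^sub>t c'\<close> of a curve \<open>c\<close> in
\<open>M\<close> to the part of \<open>(u \<circ> c)''\<close> tangent to the image of \<open>u\<close>, that is,
\<open>\<langle>du X, (u \<circ> c)''\<rangle> = g(X, \<nabla>\<^sub>t c')\<close> for every tangent vector \<open>X\<close>. The heart of the proof is that this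
identity survives for \<open>u\<close> of class \<open>C\<^sup>1\<close>, as long as \<open>u \<circ> c\<close> is \<open>C\<^sup>2\<close>
(\<open>second_order_identity\<close>). It is the first variation of energy: push \<open>c\<close> to \<open>c + s X\<close> in a chart,
where \<open>\<Phi>(s,t) = u (c(t) + s X)\<close>, and compare with the fixed curve \<open>k = u \<circ> c\<close>. The elementary
inequality \<open>(w - k') \<bullet> k' \<le> (\<bar>w\<bar>\<^sup>2 - \<bar>k'\<bar>\<^sup>2) / 2\<close> with \<open>w = \<partial>\<^sub>t \<Phi>\<close> bounds the derivative of
\<open>(\<Phi> - k) \<bullet> k'\<close> in \<open>t\<close> by a quantity that involves \<open>u\<close> only through \<open>\<bar>\<partial>\<^sub>t \<Phi>\<bar>\<^sup>2\<close>, which is the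
smooth function \<open>g(c', c')\<close> at \<open>c + s X\<close>, and through \<open>\<Phi>\<close> itself; second derivatives of \<open>u\<close> never
occur. Dividing by \<open>s\<close> and by \<open>t\<close> gives the identity as an inequality, and replacing \<open>X\<close> by \<open>-X\<close>
reverses it.

Now take for \<open>c\<close> a coordinate line of \<open>\<Sigma>\<close> through \<open>p\<close> with velocity \<open>v\<close>. Then \<open>u \<circ> c = f \<circ> c\<close>
is smooth, \<open>h(v,v) = g(\<nu>, \<nabla>\<^sub>t c')\<close>, and the second fundamental form of \<open>f\<close> has \<open>II(v,v)\<close> equal to the normal part of \<open>(f \<circ> c)''\<close>
(\<open>second_fundamental_form_in_charts\<close>, \<open>normal_part_decomposition\<close>). The vector \<open>du \<nu>\<close> has length 1
and is orthogonal to \<open>df(T\<^sub>p\<Sigma>) = du(T\<^sub>p\<Sigma>)\<close>, because \<open>du\<close> is isometric at \<open>p\<close>. The identity with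
\<open>X = \<nu>\<close> therefore reads \<open>h(v,v) = \<langle>du \<nu>, II(v,v)\<rangle>\<close>, and the Cauchy-Schwarz inequality gives
\<open>\<bar>h(v,v)\<bar> \<le> \<bar>II(v,v)\<bar>\<close>, a contradiction.
\<close>

section \<open>Acceleration under isometries of class \<open>C\<^sup>1\<close>\<close>

text \<open>The Gram form \<open>u' y a \<bullet> u' y b\<close> is bilinear in \<open>a\<close>, \<open>b\<close>, hence so is its derivative in \<open>y\<close>.
  The derivatives for basis vectors alone, which have no varying vector arguments, then control the
  joint dependence of \<open>G' a a y X\<close> on \<open>a\<close> and \<open>y\<close>.\<close>

lemma gram_has_derivative_Basis:
  fixes u' :: "'a::euclidean_space \<Rightarrow> 'a \<Rightarrow> 'b::real_inner"
  assumes V: "open V" "x \<in> V"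
    and lin: "\<And>y. y \<in> V \<Longrightarrow> linear (u' y)"
    and G': "\<And>a b. ((\<lambda>y. u' y a \<bullet> u' y b) has_derivative G' a b x) (at x)"
  shows "G' a b x h = (\<Sum>i\<in>Basis. \<Sum>j\<in>Basis. (a \<bullet> i) * (b \<bullet> j) * G' i j x h)"
proof -
  have expand: "(\<Sum>i\<in>Basis. \<Sum>j\<in>Basis. (a \<bullet> i) * (b \<bullet> j) * (u' y i \<bullet> u' y j)) = u' y a \<bullet> u' y b"
    if "y \<in> V" for y
  proof -
    have e: "u' y z = (\<Sum>i\<in>Basis. (z \<bullet> i) *\<^sub>R u' y i)" for z
      using linear_sum[OF lin[OF that], of "\<lambda>i. (z \<bullet> i) *\<^sub>R i" Basis]
      by (simp add: euclidean_representation linear_scale[OF lin[OF that]])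
    show ?thesis
      unfolding e[of a] e[of b]
      by (subst inner_sum_left, subst inner_sum_right) (simp add: mult_ac)
  qed
  have "((\<lambda>y. \<Sum>i\<in>Basis. \<Sum>j\<in>Basis. (a \<bullet> i) * (b \<bullet> j) * (u' y i \<bullet> u' y j)) has_derivative
      (\<lambda>h. \<Sum>i\<in>Basis. \<Sum>j\<in>Basis. (a \<bullet> i) * (b \<bullet> j) * G' i j x h)) (at x)"
    by (intro has_derivative_sum has_derivative_mult_right G')
  then have "((\<lambda>y. u' y a \<bullet> u' y b) has_derivative
      (\<lambda>h. \<Sum>i\<in>Basis. \<Sum>j\<in>Basis. (a \<bullet> i) * (b \<bullet> j) * G' i j x h)) (at x)"
    by (rule has_derivative_transform_within_open[OF _ V]) (rule expand)
  from has_derivative_unique[OF G' this] show ?thesis by meson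
qed

text \<open>The product rule for \<open>g(X, c')\<close> along \<open>c\<close>. Differentiating the factor \<open>u' (c t) (c1 t)\<close> itself
  is impossible, since \<open>u'\<close> is only continuous; expanding \<open>c1 t\<close> in a basis leaves Gram coefficients,
  which are differentiable.\<close>

lemma gram_along_curve_deriv:
  fixes u' :: "'a::euclidean_space \<Rightarrow> 'a \<Rightarrow> 'b::real_inner" and c c1 :: "real \<Rightarrow> 'a"
  assumes V: "open V" "\<And>t. \<bar>t\<bar> < r \<Longrightarrow> c t \<in> V" "0 < r"
    and lin: "\<And>y. y \<in> V \<Longrightarrow> linear (u' y)"
    and G': "\<And>a b x. x \<in> V \<Longrightarrow> ((\<lambda>y. u' y a \<bullet> u' y b) has_derivative G' a b x) (at x)"
    and c: "(c has_vector_derivative c1 0) (at 0)"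
    and c1: "(c1 has_vector_derivative c2) (at 0)"
  shows "((\<lambda>t. u' (c t) X \<bullet> u' (c t) (c1 t)) has_real_derivative
      u' (c 0) X \<bullet> u' (c 0) c2 + G' X (c1 0) (c 0) (c1 0)) (at 0)"
proof -
  have c0: "c 0 \<in> V" using V by simp
  have e: "u' y z = (\<Sum>i\<in>Basis. (z \<bullet> i) *\<^sub>R u' y i)" if "y \<in> V" for y z
    using linear_sum[OF lin[OF that], of "\<lambda>i. (z \<bullet> i) *\<^sub>R i" Basis]
    by (simp add: euclidean_representation linear_scale[OF lin[OF that]])
  have e2: "u' y X \<bullet> u' y z = (\<Sum>j\<in>Basis. (z \<bullet> j) * (u' y X \<bullet> u' y j))" if "y \<in> V" for y z
    by (subst (2) e[OF that]) (simp add: inner_sum_right)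
  have Gc: "((\<lambda>t. u' (c t) X \<bullet> u' (c t) j) has_real_derivative G' X j (c 0) (c1 0)) (at 0)" for j
  proof -
    have "((\<lambda>t. u' (c t) X \<bullet> u' (c t) j) has_derivative (\<lambda>h. G' X j (c 0) (h *\<^sub>R c1 0))) (at 0)"
      using has_derivative_compose[OF c[unfolded has_vector_derivative_def] G'[OF c0]] .
    moreover have "G' X j (c 0) (h *\<^sub>R c1 0) = h * G' X j (c 0) (c1 0)" for h
      using linear_scale[OF has_derivative_linear[OF G'[OF c0]]] by simp
    ultimately show ?thesis by (auto intro: has_derivative_imp_has_field_derivative)
  qed
  have c1j: "((\<lambda>t. c1 t \<bullet> j) has_real_derivative c2 \<bullet> j) (at 0)" for j
    by (rule has_derivative_imp_has_field_derivative[OF has_derivative_inner_left[OF c1[unfolded has_vector_derivative_def], of j]])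
       simp
  have "((\<lambda>t. \<Sum>j\<in>Basis. (c1 t \<bullet> j) * (u' (c t) X \<bullet> u' (c t) j)) has_real_derivative
      (\<Sum>j\<in>Basis. (c2 \<bullet> j) * (u' (c 0) X \<bullet> u' (c 0) j) + G' X j (c 0) (c1 0) * (c1 0 \<bullet> j))) (at 0)"
    by (intro DERIV_sum DERIV_mult Gc c1j)
  moreover have "(\<Sum>j\<in>Basis. (c2 \<bullet> j) * (u' (c 0) X \<bullet> u' (c 0) j) + G' X j (c 0) (c1 0) * (c1 0 \<bullet> j))
     = u' (c 0) X \<bullet> u' (c 0) c2 + G' X (c1 0) (c 0) (c1 0)"
  proof -
    have "((\<lambda>y. \<Sum>j\<in>Basis. (c1 0 \<bullet> j) * (u' y X \<bullet> u' y j)) has_derivative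
        (\<lambda>h. \<Sum>j\<in>Basis. (c1 0 \<bullet> j) * G' X j (c 0) h)) (at (c 0))"
      by (intro has_derivative_sum has_derivative_mult_right G' c0)
    then have "((\<lambda>y. u' y X \<bullet> u' y (c1 0)) has_derivative
        (\<lambda>h. \<Sum>j\<in>Basis. (c1 0 \<bullet> j) * G' X j (c 0) h)) (at (c 0))"
      by (rule has_derivative_transform_within_open[OF _ V(1) c0]) (simp add: e2)
    from has_derivative_unique[OF G'[OF c0] this]
    have "G' X (c1 0) (c 0) (c1 0) = (\<Sum>j\<in>Basis. (c1 0 \<bullet> j) * G' X j (c 0) (c1 0))" by meson
    then show ?thesis by (simp add: e2[OF c0, of c2] sum.distrib mult.commute)
  qed
  ultimately have "((\<lambda>t. \<Sum>j\<in>Basis. (c1 t \<bullet> j) * (u' (c t) X \<bullet> u' (c t) j)) has_real_derivative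
      u' (c 0) X \<bullet> u' (c 0) c2 + G' X (c1 0) (c 0) (c1 0)) (at 0)" by simp
  then show ?thesis
    by (rule has_field_derivative_transform_within[OF _ V(3)]) (use e2 V(2) in auto)
qed

text \<open>One half of the first variation argument. For fixed \<open>s > 0\<close>, the derivative of
  \<open>P t = (u (c t + s X) - k t) \<bullet> k1 t\<close> is at most \<open>s (R + e)\<close> near the origin, where \<open>R\<close> is the right-hand side; integrating in \<open>t\<close>
  and letting first \<open>s\<close> and then \<open>t\<close> tend to 0 from the right turns this into the claim.\<close>

lemma second_order_identity_le:
  fixes u :: "'a::euclidean_space \<Rightarrow> 'b::real_inner" and c c1 :: "real \<Rightarrow> 'a"
  assumes V: "open V" "\<And>t. \<bar>t\<bar> < r \<Longrightarrow> c t \<in> V" "0 < r"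
    and u: "\<And>x. x \<in> V \<Longrightarrow> (u has_derivative u' x) (at x)"
    and u'_cont: "\<And>a. continuous_on V (\<lambda>x. u' x a)"
    and G': "\<And>a b x. x \<in> V \<Longrightarrow> ((\<lambda>y. u' y a \<bullet> u' y b) has_derivative G' a b x) (at x)"
    and G'_cont: "\<And>a b e. continuous_on V (\<lambda>x. G' a b x e)"
    and c: "\<And>t. \<bar>t\<bar> < r \<Longrightarrow> (c has_vector_derivative c1 t) (at t)"
    and c1: "(c1 has_vector_derivative c2) (at 0)"
    and k: "\<And>t. \<bar>t\<bar> < r \<Longrightarrow> u (c t) = k t"
      "\<And>t. \<bar>t\<bar> < r \<Longrightarrow> (k has_vector_derivative k1 t) (at t)"
      "\<And>t. \<bar>t\<bar> < r \<Longrightarrow> (k1 has_vector_derivative k2 t) (at t)"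
      "isCont k2 0"
  shows "u' (c 0) X \<bullet> u' (c 0) c2 + G' X (c1 0) (c 0) (c1 0)
       \<le> G' (c1 0) (c1 0) (c 0) X / 2 + u' (c 0) X \<bullet> k2 0" (is "?m' \<le> ?R")
proof (rule field_le_epsilon)
  fix e :: real assume e: "0 < e"
  have lin: "linear (u' y)" if "y \<in> V" for y
    using has_derivative_linear[OF u[OF that]] .
  have c0: "c 0 \<in> V" using V by simp
  have G'_sum: "G' a a y X = (\<Sum>i\<in>Basis. \<Sum>j\<in>Basis. (a \<bullet> i) * (a \<bullet> j) * G' i j y X)"
    if "y \<in> V" for a y
    by (rule gram_has_derivative_Basis[where u' = u' and G' = G', OF V(1) that lin G'[OF that]])
  \<comment> \<open>\<open>Q t s\<close> is the \<open>s\<close>-derivative of \<open>\<bar>\<partial>\<^sub>t u (c t + s X)\<bar>\<^sup>2 / 2 + u (c t + s X) \<bullet> k2 t\<close>,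
    in the basis expansion that makes its joint continuity in \<open>t\<close> and \<open>s\<close> visible.\<close>
  define Q where "Q t s = (\<Sum>i\<in>Basis. \<Sum>j\<in>Basis. (c1 t \<bullet> i) * (c1 t \<bullet> j) * G' i j (c t + s *\<^sub>R X) X) / 2
      + u' (c t + s *\<^sub>R X) X \<bullet> k2 t" for t s
  have Q0: "Q 0 0 = ?R" by (simp add: Q_def G'_sum[OF c0])
  have cont_c: "isCont c 0" using c[of 0] V(3) has_vector_derivative_continuous by force
  have cont_c1: "isCont c1 0" using c1 has_vector_derivative_continuous by blast
  have fst0: "((\<lambda>z::real\<times>real. h (fst z)) \<longlongrightarrow> h 0) (nhds (0,0))" if "isCont h 0" for h :: "real \<Rightarrow> 'z::topological_space"
  proof -
    have "(fst \<longlongrightarrow> (0::real)) (nhds (0::real,0::real))"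
      using tendsto_fst[OF filterlim_ident, of "(0::real,0::real)"] by simp
    moreover have "(h \<longlongrightarrow> h 0) (nhds 0)"
      using that by (simp add: isCont_def tendsto_at_iff_tendsto_nhds)
    ultimately show ?thesis by (rule filterlim_compose[rotated])
  qed
  have x0: "((\<lambda>z::real\<times>real. c (fst z) + snd z *\<^sub>R X) \<longlongrightarrow> c 0) (nhds (0,0))"
    by (rule tendsto_eq_rhs[OF tendsto_add[OF fst0[OF cont_c]
          tendsto_scaleR[OF tendsto_snd[OF filterlim_ident] tendsto_const]]]) simp
  have comp: "((\<lambda>z::real\<times>real. h (c (fst z) + snd z *\<^sub>R X)) \<longlongrightarrow> h (c 0)) (nhds (0,0))"
    if "continuous_on V h" for h :: "'a \<Rightarrow> 'z::topological_space"
  proof -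
    have "isCont h (c 0)" using that V(1) c0 continuous_on_eq_continuous_at by blast
    then have "(h \<longlongrightarrow> h (c 0)) (nhds (c 0))" by (simp add: isCont_def tendsto_at_iff_tendsto_nhds)
    from filterlim_compose[OF this x0] show ?thesis .
  qed
  have "((\<lambda>z. Q (fst z) (snd z)) \<longlongrightarrow> Q 0 0) (nhds (0,0))"
    unfolding Q_def
    by (intro tendsto_add tendsto_divide tendsto_sum tendsto_mult tendsto_inner
        fst0[OF cont_c1] tendsto_const fst0[OF k(4)])
       (use comp[OF G'_cont] comp[OF u'_cont] in auto)
  then have "eventually (\<lambda>z. Q (fst z) (snd z) < ?R + e) (nhds (0,0))"
    by (rule order_tendstoD) (simp add: Q0 e)
  moreover have "eventually (\<lambda>z::real\<times>real. c (fst z) + snd z *\<^sub>R X \<in> V) (nhds (0,0))"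
    using topological_tendstoD[OF x0 V(1) c0] .
  ultimately have "eventually (\<lambda>z::real\<times>real. c (fst z) + snd z *\<^sub>R X \<in> V \<and> Q (fst z) (snd z) < ?R + e) (nhds (0,0))"
    by eventually_elim simp
  then obtain d0 where d0: "d0 > 0" "\<And>t s. dist (t,s) (0,0) < d0 \<Longrightarrow> c t + s *\<^sub>R X \<in> V \<and> Q t s < ?R + e"
    unfolding eventually_nhds_metric by auto
  define d where "d = min r (d0 / 2)"
  have d: "d > 0" "d \<le> r" using d0 V(3) by (auto simp: d_def)
  have near: "c t + s *\<^sub>R X \<in> V \<and> Q t s < ?R + e" if "\<bar>t\<bar> < d" "\<bar>s\<bar> < d" for t s
  proof (rule d0(2))
    have "dist (t,s) (0,0) \<le> \<bar>t\<bar> + \<bar>s\<bar>"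
      using sqrt_sum_squares_le_sum_abs[of t s] by (simp add: dist_prod_def)
    also have "\<dots> < d0" using that by (simp add: d_def)
    finally show "dist (t,s) (0,0) < d0" .
  qed
  have line: "((\<lambda>s. u (c t + s *\<^sub>R X) \<bullet> w) has_real_derivative u' (c t + s *\<^sub>R X) X \<bullet> w) (at s)"
    if "c t + s *\<^sub>R X \<in> V" for t s w
  proof -
    have "((\<lambda>s. c t + s *\<^sub>R X) has_derivative (\<lambda>h. h *\<^sub>R X)) (at s)"
      by (auto intro!: derivative_eq_intros)
    from has_derivative_inner_left[OF has_derivative_compose[OF this u[OF that]], of w]
    show ?thesis
      by (rule has_derivative_imp_has_field_derivative) (simp add: linear_scale[OF lin[OF that]])
  qed
  have lineG: "((\<lambda>s. u' (c t + s *\<^sub>R X) a \<bullet> u' (c t + s *\<^sub>R X) a) has_real_derivative G' a a (c t + s *\<^sub>R X) X) (at s)"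
    if "c t + s *\<^sub>R X \<in> V" for t s a
  proof -
    have "((\<lambda>s. c t + s *\<^sub>R X) has_derivative (\<lambda>h. h *\<^sub>R X)) (at s)"
      by (auto intro!: derivative_eq_intros)
    from has_derivative_compose[OF this G'[OF that]]
    show ?thesis
      by (rule has_derivative_imp_has_field_derivative)
         (simp add: linear_scale[OF has_derivative_linear[OF G'[OF that]]])
  qed
  have k1: "k1 t = u' (c t) (c1 t)" if "\<bar>t\<bar> < r" for t
  proof -
    have "((\<lambda>t. u (c t)) has_vector_derivative u' (c t) (c1 t)) (at t)"
      using has_derivative_compose[OF c[OF that, unfolded has_vector_derivative_def] u[OF V(2)[OF that]]]
      by (simp add: has_vector_derivative_def linear_scale[OF lin[OF V(2)[OF that]]])
    moreover have "((\<lambda>t. u (c t)) has_vector_derivative k1 t) (at t)"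
      by (rule has_vector_derivative_transform_within_open[OF k(2)[OF that], of "{-r<..<r}"])
         (use that k(1) in auto)
    ultimately show ?thesis by (rule vector_derivative_unique_at[symmetric])
  qed
  \<comment> \<open>\<open>m\<close> is \<open>g(X, c')\<close> along \<open>c\<close>, the limit of \<open>P / s\<close> as \<open>s\<close> tends to 0; its derivative at 0 is the left-hand side.\<close>
  define m where "m t = u' (c t) X \<bullet> k1 t" for t
  have bound: "(u (c t + s *\<^sub>R X) - k t) \<bullet> k1 t - (u (c 0 + s *\<^sub>R X) - k 0) \<bullet> k1 0 \<le> t * s * (?R + e)"
    if t: "0 < t" "t < d" and s: "0 < s" "s < d" for t s
  proof -
    define P where "P t = (u (c t + s *\<^sub>R X) - k t) \<bullet> k1 t" for t
    define P' where "P' t = (u' (c t + s *\<^sub>R X) (c1 t) - k1 t) \<bullet> k1 t + (u (c t + s *\<^sub>R X) - k t) \<bullet> k2 t" for t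
    have dP: "(P has_real_derivative P' x) (at x)" if "\<bar>x\<bar> < d" for x
    proof -
      have x: "c x + s *\<^sub>R X \<in> V" "\<bar>x\<bar> < r" using near[OF that, of s] s d that by auto
      have "((\<lambda>t. c t + s *\<^sub>R X) has_derivative (\<lambda>h. h *\<^sub>R c1 x)) (at x)"
        using c[OF x(2)] by (auto simp: has_vector_derivative_def intro!: derivative_eq_intros)
      from has_derivative_compose[OF this u[OF x(1)]]
      have ux: "((\<lambda>t. u (c t + s *\<^sub>R X)) has_derivative (\<lambda>h. h *\<^sub>R u' (c x + s *\<^sub>R X) (c1 x))) (at x)"
        by (simp add: linear_scale[OF lin[OF x(1)]])
      have "(P has_derivative (\<lambda>h. (u (c x + s *\<^sub>R X) - k x) \<bullet> (h *\<^sub>R k2 x)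
          + (h *\<^sub>R u' (c x + s *\<^sub>R X) (c1 x) - h *\<^sub>R k1 x) \<bullet> k1 x)) (at x)"
        unfolding P_def
        by (intro has_derivative_inner has_derivative_diff ux
             k(2)[OF x(2), unfolded has_vector_derivative_def] k(3)[OF x(2), unfolded has_vector_derivative_def])
      then show ?thesis
        by (rule has_derivative_imp_has_field_derivative) (simp add: P'_def algebra_simps inner_diff_left)
    qed
    have P'_le: "P' x \<le> s * (?R + e)" if x: "\<bar>x\<bar> < d" for x
    proof -
      have xr: "\<bar>x\<bar> < r" using x d by simp
      have "\<exists>z>0. z < s \<and> (u' (c x + s *\<^sub>R X) (c1 x) \<bullet> u' (c x + s *\<^sub>R X) (c1 x)) / 2 + u (c x + s *\<^sub>R X) \<bullet> k2 x
          - ((u' (c x + 0 *\<^sub>R X) (c1 x) \<bullet> u' (c x + 0 *\<^sub>R X) (c1 x)) / 2 + u (c x + 0 *\<^sub>R X) \<bullet> k2 x) = (s - 0) * Q x z"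
      proof (rule MVT2[OF s(1)])
        fix z assume z: "0 \<le> z" "z \<le> s"
        have zO: "c x + z *\<^sub>R X \<in> V" using near[OF x, of z] z s by simp
        show "((\<lambda>z. (u' (c x + z *\<^sub>R X) (c1 x) \<bullet> u' (c x + z *\<^sub>R X) (c1 x)) / 2 + u (c x + z *\<^sub>R X) \<bullet> k2 x)
           has_real_derivative Q x z) (at z)"
          unfolding Q_def G'_sum[OF zO, symmetric]
          by (intro DERIV_add DERIV_cdivide line lineG zO)
      qed
      then obtain z where z: "0 < z" "z < s" and
        eq: "(u' (c x + s *\<^sub>R X) (c1 x) \<bullet> u' (c x + s *\<^sub>R X) (c1 x)) / 2 + u (c x + s *\<^sub>R X) \<bullet> k2 x
          - ((k1 x \<bullet> k1 x) / 2 + k x \<bullet> k2 x) = s * Q x z"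
        using k1[OF xr] k(1)[OF xr] by auto
      define w where "w = u' (c x + s *\<^sub>R X) (c1 x)"
      \<comment> \<open>This inequality removes the uncontrolled mixed derivative of \<open>u\<close>: only the length of \<open>w\<close>,
          a value of the metric, is left.\<close>
      have "(w - k1 x) \<bullet> k1 x \<le> (w \<bullet> w) / 2 - (k1 x \<bullet> k1 x) / 2"
        using inner_ge_zero[of "w - k1 x"] by (simp add: inner_diff_left inner_diff_right inner_commute)
      then have "P' x \<le> s * Q x z"
        using eq by (simp add: P'_def w_def inner_diff_left)
      also have "\<dots> \<le> s * (?R + e)"
        using near[OF x, of z] z s by (intro mult_left_mono) auto
      finally show ?thesis .
    qed
    have "\<exists>z>0. z < t \<and> P t - P 0 = (t - 0) * P' z"
      by (rule MVT2[OF t(1)]) (use t dP in auto)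
    then obtain z where z: "0 < z" "z < t" "P t - P 0 = t * P' z" by auto
    have "t * P' z \<le> t * (s * (?R + e))"
      using P'_le[of z] z t by (intro mult_left_mono) auto
    then show ?thesis using z by (simp add: P_def mult.assoc)
  qed
  have lim: "((\<lambda>s. ((u (c t + s *\<^sub>R X) - k t) \<bullet> k1 t) / s) \<longlongrightarrow> m t) (at_right 0)" if "\<bar>t\<bar> < r" for t
  proof -
    have "((\<lambda>s. u (c t + s *\<^sub>R X) \<bullet> k1 t) has_real_derivative m t) (at 0)"
      using line[of t 0 "k1 t"] V(2)[OF that] by (simp add: m_def)
    then have "((\<lambda>s. (u (c t + s *\<^sub>R X) \<bullet> k1 t - u (c t) \<bullet> k1 t) / s) \<longlongrightarrow> m t) (at 0)"
      by (simp add: DERIV_def)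
    then show ?thesis
      by (simp add: inner_diff_left k(1)[OF that] filterlim_at_split)
  qed
  have m_le: "(m t - m 0) / t \<le> ?R + e" if t: "0 < t" "t < d" for t
  proof -
    have "((\<lambda>s. ((u (c t + s *\<^sub>R X) - k t) \<bullet> k1 t) / s - ((u (c 0 + s *\<^sub>R X) - k 0) \<bullet> k1 0) / s) \<longlongrightarrow> m t - m 0) (at_right 0)"
      using t d V(3) by (intro tendsto_diff lim) auto
    moreover have "eventually (\<lambda>s. ((u (c t + s *\<^sub>R X) - k t) \<bullet> k1 t) / s - ((u (c 0 + s *\<^sub>R X) - k 0) \<bullet> k1 0) / s \<le> t * (?R + e)) (at_right 0)"
      using eventually_at_right_real[OF d(1)]
    proof eventually_elim
      case (elim s)
      then have "((u (c t + s *\<^sub>R X) - k t) \<bullet> k1 t - (u (c 0 + s *\<^sub>R X) - k 0) \<bullet> k1 0) / s \<le> t * (?R + e)"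
        using bound[OF t, of s] by (simp add: divide_le_eq mult_ac)
      then show ?case by (simp add: diff_divide_distrib)
    qed
    ultimately have "m t - m 0 \<le> t * (?R + e)"
      by (rule tendsto_upperbound) simp
    then show ?thesis using t by (simp add: divide_le_eq mult.commute)
  qed
  have "(m has_real_derivative ?m') (at 0)"
    by (rule has_field_derivative_transform_within[OF gram_along_curve_deriv[OF V lin G' c c1, of X] V(3)])
       (use k1 V(3) in \<open>auto simp: m_def\<close>)
  then have "((\<lambda>t. (m t - m 0) / t) \<longlongrightarrow> ?m') (at_right 0)"
    by (simp add: DERIV_def filterlim_at_split)
  moreover have "eventually (\<lambda>t. (m t - m 0) / t \<le> ?R + e) (at_right 0)"
    using eventually_at_right_real[OF d(1)] by eventually_elim (simp add: m_le)
  ultimately show "?m' \<le> ?R + e"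
    by (rule tendsto_upperbound) simp
qed

text \<open>For a metric \<open>G x a b = u' x a \<bullet> u' x b\<close>, the right-hand side is \<open>G(X, \<nabla>\<^sub>t c')\<close> in coordinates, so
  an isometric map of class \<open>C\<^sup>1\<close> preserves tangential acceleration along every curve whose image is
  twice continuously differentiable. Both sides of the inequality above are odd in \<open>X\<close>, which yields equality.\<close>

lemma second_order_identity:
  fixes u :: "'a::euclidean_space \<Rightarrow> 'b::real_inner" and c c1 :: "real \<Rightarrow> 'a"
  assumes V: "open V" "\<And>t. \<bar>t\<bar> < r \<Longrightarrow> c t \<in> V" "0 < r"
    and u: "\<And>x. x \<in> V \<Longrightarrow> (u has_derivative u' x) (at x)"
    and u'_cont: "\<And>a. continuous_on V (\<lambda>x. u' x a)"
    and G': "\<And>a b x. x \<in> V \<Longrightarrow> ((\<lambda>y. u' y a \<bullet> u' y b) has_derivative G' a b x) (at x)"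
    and G'_cont: "\<And>a b e. continuous_on V (\<lambda>x. G' a b x e)"
    and c: "\<And>t. \<bar>t\<bar> < r \<Longrightarrow> (c has_vector_derivative c1 t) (at t)"
    and c1: "(c1 has_vector_derivative c2) (at 0)"
    and k: "\<And>t. \<bar>t\<bar> < r \<Longrightarrow> u (c t) = k t"
      "\<And>t. \<bar>t\<bar> < r \<Longrightarrow> (k has_vector_derivative k1 t) (at t)"
      "\<And>t. \<bar>t\<bar> < r \<Longrightarrow> (k1 has_vector_derivative k2 t) (at t)"
      "isCont k2 0"
  shows "u' (c 0) X \<bullet> k2 0 =
      u' (c 0) X \<bullet> u' (c 0) c2 + G' X (c1 0) (c 0) (c1 0) - G' (c1 0) (c1 0) (c 0) X / 2"
proof -
  have c0: "c 0 \<in> V" using V by simp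
  have u'_lin: "u' (c 0) (- X) = - u' (c 0) X"
    using linear_neg[OF has_derivative_linear[OF u[OF c0]]] .
  have G'_dir: "G' (c1 0) (c1 0) (c 0) (- X) = - G' (c1 0) (c1 0) (c 0) X"
    using linear_neg[OF has_derivative_linear[OF G'[OF c0]]] .
  have G'_arg: "G' (- X) (c1 0) (c 0) e = - G' X (c1 0) (c 0) e" for e
    by (simp add: sum_negf gram_has_derivative_Basis[where u' = u' and G' = G',
        OF V(1) c0 has_derivative_linear[OF u] G'[OF c0], of _ "c1 0" e])
  note le = second_order_identity_le[OF assms]
  show ?thesis
    using le[of X] le[of "- X"] by (simp add: u'_lin G'_dir G'_arg)
qed

section \<open>Charts, tangent vectors and differentials\<close>

lemma frechet_derivative_eqI:
  "(f has_derivative f') (at x) \<Longrightarrow> frechet_derivative f (at x) = f'"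
  by (rule frechet_derivative_at[symmetric])

lemma chart_inv_left:
  assumes "is_chart X \<phi>" "x \<in> fst \<phi>"
  shows "chart_inv \<phi> (snd \<phi> x) = x"
proof -
  have "inj_on (snd \<phi>) (topspace (subtopology X (fst \<phi>)))"
    using assms(1) homeomorphic_imp_injective_map unfolding is_chart_def by blast
  moreover have "topspace (subtopology X (fst \<phi>)) = fst \<phi>"
    using assms(1) openin_subset unfolding is_chart_def by fastforce
  ultimately show ?thesis using assms(2) by (simp add: chart_inv_def)
qed

lemma chart_inv_right: "y \<in> snd \<phi> ` fst \<phi> \<Longrightarrow> snd \<phi> (chart_inv \<phi> y) = y"
  by (simp add: chart_inv_def f_inv_into_f)

lemma open_chart_image:
  assumes "is_chart X \<phi>" "openin X W"
  shows "open (snd \<phi> ` (fst \<phi> \<inter> W))"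
proof -
  have "openin (subtopology X (fst \<phi>)) (fst \<phi> \<inter> W)"
    using assms(2) by (rule openin_subtopology_Int2)
  moreover have "open_map (subtopology X (fst \<phi>)) (top_of_set (snd \<phi> ` fst \<phi>)) (snd \<phi>)"
    using assms(1) homeomorphic_imp_open_map unfolding is_chart_def by blast
  ultimately have "openin (top_of_set (snd \<phi> ` fst \<phi>)) (snd \<phi> ` (fst \<phi> \<inter> W))"
    unfolding open_map_def by blast
  then show ?thesis
    using assms(1) openin_open_trans unfolding is_chart_def by blast
qed

lemma charts_atD:
  assumes "smooth_manifold M" "\<phi> \<in> charts_at M x"
  shows "is_chart (mtop M) \<phi>" "x \<in> fst \<phi>" "\<phi> \<in> atlas M" "x \<in> pts M"
  using assms by (auto simp: smooth_manifold_def charts_at_def)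

lemma chart_at_in_charts_at:
  assumes "smooth_manifold M" "x \<in> pts M"
  shows "chart_at M x \<in> charts_at M x"
proof -
  obtain \<phi> where "\<phi> \<in> charts_at M x"
    using assms by (auto simp: smooth_manifold_def charts_at_def)
  then show ?thesis unfolding chart_at_def by (rule someI)
qed

lemma transition_differentiable:
  assumes M: "smooth_manifold M" and \<phi>: "\<phi> \<in> charts_at M x" and \<psi>: "\<psi> \<in> charts_at M x"
  shows "(snd \<psi> \<circ> chart_inv \<phi>) differentiable at (snd \<phi> x)"
proof -
  have "smooth_on (snd \<psi> \<circ> chart_inv \<phi>) (snd \<phi> ` (fst \<phi> \<inter> fst \<psi>))"
    using assms by (auto simp: smooth_manifold_def charts_at_def)
  then have "Ck_on (Suc 0) (snd \<psi> \<circ> chart_inv \<phi>) (snd \<phi> ` (fst \<phi> \<inter> fst \<psi>))"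
    unfolding smooth_on_def by blast
  then show ?thesis
    using charts_atD(2)[OF M \<phi>] charts_atD(2)[OF M \<psi>] by auto
qed

text \<open>The chain rule for a change of chart in the source. With \<open>H\<close> itself a chart it is the cocycle
  identity of the transition maps; with \<open>H\<close> a map read in a chart of its target it compares the
  coordinate expressions of its differential.\<close>

lemma change_source_chart:
  fixes H :: "'a \<Rightarrow> 'e::real_normed_vector"
  assumes M: "smooth_manifold M" and \<phi>: "\<phi> \<in> charts_at M x" and \<psi>: "\<psi> \<in> charts_at M x"
    and H: "(H \<circ> chart_inv \<psi>) differentiable at (snd \<psi> x)"
  shows "((H \<circ> chart_inv \<phi>) has_derivative
     (\<lambda>a. frechet_derivative (H \<circ> chart_inv \<psi>) (at (snd \<psi> x))
            (frechet_derivative (snd \<psi> \<circ> chart_inv \<phi>) (at (snd \<phi> x)) a))) (at (snd \<phi> x))"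
proof -
  note c\<phi> = charts_atD[OF M \<phi>] and c\<psi> = charts_atD[OF M \<psi>]
  have x: "(snd \<psi> \<circ> chart_inv \<phi>) (snd \<phi> x) = snd \<psi> x"
    using chart_inv_left[OF c\<phi>(1,2)] by simp
  have "((H \<circ> chart_inv \<psi>) \<circ> (snd \<psi> \<circ> chart_inv \<phi>) has_derivative
     frechet_derivative (H \<circ> chart_inv \<psi>) (at (snd \<psi> x)) \<circ>
            frechet_derivative (snd \<psi> \<circ> chart_inv \<phi>) (at (snd \<phi> x))) (at (snd \<phi> x))"
    using transition_differentiable[OF M \<phi> \<psi>] H
    by (intro diff_chain_at) (simp_all only: x frechet_derivative_works[symmetric])
  then show ?thesis
    unfolding comp_def[of "frechet_derivative _ _"]
  proof (rule has_derivative_transform_within_open)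
    show "open (snd \<phi> ` (fst \<phi> \<inter> fst \<psi>))"
      using open_chart_image c\<phi>(1) c\<psi>(1) unfolding is_chart_def by blast
    show "snd \<phi> x \<in> snd \<phi> ` (fst \<phi> \<inter> fst \<psi>)" using c\<phi>(2) c\<psi>(2) by simp
    fix y assume "y \<in> snd \<phi> ` (fst \<phi> \<inter> fst \<psi>)"
    then show "(H \<circ> chart_inv \<psi> \<circ> (snd \<psi> \<circ> chart_inv \<phi>)) y = (H \<circ> chart_inv \<phi>) y"
      using chart_inv_left[OF c\<phi>(1)] chart_inv_left[OF c\<psi>(1)] by auto
  qed
qed

lemma transition_id:
  assumes M: "smooth_manifold M" and \<phi>: "\<phi> \<in> charts_at M x"
  shows "frechet_derivative (snd \<phi> \<circ> chart_inv \<phi>) (at (snd \<phi> x)) = (\<lambda>a. a)"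
proof (rule frechet_derivative_eqI)
  show "((snd \<phi> \<circ> chart_inv \<phi>) has_derivative (\<lambda>a. a)) (at (snd \<phi> x))"
    by (rule has_derivative_transform_within_open[OF has_derivative_ident, of "snd \<phi> ` fst \<phi>"])
       (use charts_atD[OF M \<phi>] in \<open>auto simp: is_chart_def chart_inv_right\<close>)
qed

lemma tvec_of_self:
  assumes "smooth_manifold M" "\<phi> \<in> charts_at M x"
  shows "tvec_of M x \<phi> a \<phi> = a"
  using assms by (simp add: tvec_of_def transition_id)

lemma tvec_of_in_tangent_space:
  assumes M: "smooth_manifold M" and \<phi>: "\<phi> \<in> charts_at M x"
  shows "tvec_of M x \<phi> a \<in> tangent_space M x"
proof -
  have "frechet_derivative (snd \<theta> \<circ> chart_inv \<phi>) (at (snd \<phi> x)) a =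
      frechet_derivative (snd \<theta> \<circ> chart_inv \<psi>) (at (snd \<psi> x))
         (frechet_derivative (snd \<psi> \<circ> chart_inv \<phi>) (at (snd \<phi> x)) a)"
    if \<psi>: "\<psi> \<in> charts_at M x" and \<theta>: "\<theta> \<in> charts_at M x" for \<psi> \<theta>
    using fun_cong[OF frechet_derivative_eqI[OF
      change_source_chart[OF M \<phi> \<psi> transition_differentiable[OF M \<psi> \<theta>]]]] .
  note cocycle = this
  show ?thesis
    unfolding tangent_space_def
  proof (intro CollectI conjI ballI allI impI)
    fix \<psi> \<theta> assume h: "\<psi> \<in> charts_at M x" "\<theta> \<in> charts_at M x"
    show "tvec_of M x \<phi> a \<theta> =
        frechet_derivative (snd \<theta> \<circ> chart_inv \<psi>) (at (snd \<psi> x)) (tvec_of M x \<phi> a \<psi>)"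
      using cocycle[OF h] by (simp only: tvec_of_def h if_True)
  qed (simp add: tvec_of_def)
qed

lemma tvec_of_component:
  assumes "\<phi> \<in> charts_at M x" "\<xi> \<in> tangent_space M x"
  shows "tvec_of M x \<phi> (\<xi> \<phi>) = \<xi>"
proof
  fix \<psi>
  show "tvec_of M x \<phi> (\<xi> \<phi>) \<psi> = \<xi> \<psi>"
  proof (cases "\<psi> \<in> charts_at M x")
    case True
    then have "\<xi> \<psi> = frechet_derivative (snd \<psi> \<circ> chart_inv \<phi>) (at (snd \<phi> x)) (\<xi> \<phi>)"
      using assms unfolding tangent_space_def by blast
    then show ?thesis by (simp only: tvec_of_def True if_True)
  next
    case False
    then have "\<xi> \<psi> = 0" using assms(2) unfolding tangent_space_def by blast
    then show ?thesis by (simp only: tvec_of_def False if_False)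
  qed
qed

lemma tangent_eqI:
  assumes "\<phi> \<in> charts_at M x" "\<xi> \<in> tangent_space M x" "\<eta> \<in> tangent_space M x" "\<xi> \<phi> = \<eta> \<phi>"
  shows "\<xi> = \<eta>"
  using assms tvec_of_component by metis

text \<open>Transition maps have linear derivatives, so \<open>tvec_of\<close> is a linear isomorphism from the model space
  onto the tangent space, and the linear algebra below can take place in a single chart.\<close>

lemma tvec_of_lincomb:
  assumes M: "smooth_manifold M" and \<phi>: "\<phi> \<in> charts_at M x"
  shows "tvec_of M x \<phi> (r *\<^sub>R a + s *\<^sub>R b) = (\<lambda>\<psi>. r *\<^sub>R tvec_of M x \<phi> a \<psi> + s *\<^sub>R tvec_of M x \<phi> b \<psi>)"
proof
  fix \<psi>
  show "tvec_of M x \<phi> (r *\<^sub>R a + s *\<^sub>R b) \<psi> = r *\<^sub>R tvec_of M x \<phi> a \<psi> + s *\<^sub>R tvec_of M x \<phi> b \<psi>"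
  proof (cases "\<psi> \<in> charts_at M x")
    case True
    have "linear (frechet_derivative (snd \<psi> \<circ> chart_inv \<phi>) (at (snd \<phi> x)))"
      using transition_differentiable[OF M \<phi> True] linear_frechet_derivative by blast
    then show ?thesis using True by (simp add: tvec_of_def linear_add linear_scale)
  qed (simp add: tvec_of_def)
qed

lemma tangent_space_lincomb:
  assumes M: "smooth_manifold M" and "x \<in> pts M"
    and "\<xi> \<in> tangent_space M x" "\<eta> \<in> tangent_space M x"
  shows "(\<lambda>\<psi>. r *\<^sub>R \<xi> \<psi> + s *\<^sub>R \<eta> \<psi>) \<in> tangent_space M x"
proof -
  note \<phi> = chart_at_in_charts_at[OF assms(1,2)]
  show ?thesis
    using tvec_of_in_tangent_space[OF M \<phi>, of "r *\<^sub>R \<xi> (chart_at M x) + s *\<^sub>R \<eta> (chart_at M x)"]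
    by (simp only: tvec_of_lincomb[OF M \<phi>] tvec_of_component[OF \<phi> assms(3)]
        tvec_of_component[OF \<phi> assms(4)])
qed

lemma local_domain_open:
  assumes S: "smooth_manifold S" and M: "smooth_manifold M" and F: "Ck_map_on k S M U F"
    and \<psi>: "\<psi> \<in> atlas S" and \<phi>: "\<phi> \<in> atlas M"
  shows "open (snd \<psi> ` (fst \<psi> \<inter> U \<inter> F -` fst \<phi>))"
proof -
  have U: "openin (mtop S) U" "U \<subseteq> pts S"
    using F openin_subset unfolding Ck_map_on_def by blast+
  have "openin (mtop M) (fst \<phi>)" using M \<phi> by (auto simp: smooth_manifold_def is_chart_def)
  then have "openin (subtopology (mtop S) U) {x \<in> topspace (subtopology (mtop S) U). F x \<in> fst \<phi>}"
    using F openin_continuous_map_preimage unfolding Ck_map_on_def by blast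
  moreover have "{x \<in> topspace (subtopology (mtop S) U). F x \<in> fst \<phi>} = U \<inter> F -` fst \<phi>"
    using U by auto
  ultimately have "openin (mtop S) (U \<inter> F -` fst \<phi>)"
    using U(1) openin_trans_full by metis
  then show ?thesis
    using open_chart_image[of "mtop S" \<psi> "U \<inter> F -` fst \<phi>"] S \<psi>
    by (simp add: smooth_manifold_def Int_assoc)
qed

lemma local_rep_differentiable:
  assumes F: "Ck_map_on (Suc k) S M U F" "x \<in> U"
    and \<psi>: "\<psi> \<in> charts_at S x" and \<phi>: "\<phi> \<in> charts_at M (F x)"
  shows "(snd \<phi> \<circ> F \<circ> chart_inv \<psi>) differentiable at (snd \<psi> x)"
  using assms by (auto simp: Ck_map_on_def charts_at_def)

text \<open>The definition of the differential uses one chosen chart around each point. Near \<open>p\<close> that choice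
  may change from point to point, so differentiating the differential along a submanifold requires
  its expression in a fixed chart.\<close>

lemma differential_in_chart:
  assumes S: "smooth_manifold S" and F: "Ck_map_on (Suc k) S M U F" "x \<in> U"
    and \<psi>: "\<psi> \<in> charts_at S x" and \<phi>: "\<phi> \<in> charts_at M (F x)" and v: "v \<in> tangent_space S x"
  shows "differential S M F x v \<phi> = frechet_derivative (snd \<phi> \<circ> F \<circ> chart_inv \<psi>) (at (snd \<psi> x)) (v \<psi>)"
proof -
  have \<psi>0: "chart_at S x \<in> charts_at S x"
    using chart_at_in_charts_at[OF S] charts_atD(4)[OF S \<psi>] .
  have "frechet_derivative (snd \<phi> \<circ> F \<circ> chart_inv (chart_at S x)) (at (snd (chart_at S x) x)) (v (chart_at S x)) =
     frechet_derivative (snd \<phi> \<circ> F \<circ> chart_inv \<psi>) (at (snd \<psi> x))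
        (frechet_derivative (snd \<psi> \<circ> chart_inv (chart_at S x)) (at (snd (chart_at S x) x)) (v (chart_at S x)))"
    using fun_cong[OF frechet_derivative_eqI[OF
      change_source_chart[OF S \<psi>0 \<psi> local_rep_differentiable[OF F \<psi> \<phi>]]]] .
  also have "frechet_derivative (snd \<psi> \<circ> chart_inv (chart_at S x)) (at (snd (chart_at S x) x)) (v (chart_at S x)) = v \<psi>"
    by (rule sym) (use v \<psi> \<psi>0 in \<open>unfold tangent_space_def, blast\<close>)
  finally show ?thesis using \<phi> by (simp only: differential_def Let_def if_True)
qed

lemma differential_in_tangent_space:
  assumes S: "smooth_manifold S" and M: "smooth_manifold M" and F: "Ck_map_on (Suc k) S M U F" "x \<in> U"
    and v: "v \<in> tangent_space S x"
  shows "differential S M F x v \<in> tangent_space M (F x)"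
proof -
  have xS: "x \<in> pts S" using F openin_subset unfolding Ck_map_on_def by blast
  then have FM: "F x \<in> pts M"
    using F continuous_map_image_subset_topspace[of "subtopology (mtop S) U" "mtop M" F]
    unfolding Ck_map_on_def by auto
  define \<psi> where "\<psi> = chart_at S x"
  define \<phi> where "\<phi> = chart_at M (F x)"
  have \<psi>: "\<psi> \<in> charts_at S x" and \<phi>: "\<phi> \<in> charts_at M (F x)"
    unfolding \<psi>_def \<phi>_def
    using chart_at_in_charts_at[OF S xS] chart_at_in_charts_at[OF M FM] .
  note c\<psi> = charts_atD[OF S \<psi>] and c\<phi> = charts_atD[OF M \<phi>]
  have "differential S M F x v \<theta> = tvec_of M (F x) \<phi> (differential S M F x v \<phi>) \<theta>" for \<theta>
  proof (cases "\<theta> \<in> charts_at M (F x)")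
    case \<theta>: True
    let ?A = "frechet_derivative (snd \<phi> \<circ> F \<circ> chart_inv \<psi>) (at (snd \<psi> x))"
    let ?B = "frechet_derivative (snd \<theta> \<circ> chart_inv \<phi>) (at (snd \<phi> (F x)))"
    have Fx: "(snd \<phi> \<circ> F \<circ> chart_inv \<psi>) (snd \<psi> x) = snd \<phi> (F x)"
      using chart_inv_left[OF c\<psi>(1,2)] by simp
    have "((snd \<theta> \<circ> chart_inv \<phi>) \<circ> (snd \<phi> \<circ> F \<circ> chart_inv \<psi>) has_derivative ?B \<circ> ?A) (at (snd \<psi> x))"
      using transition_differentiable[OF M \<phi> \<theta>] local_rep_differentiable[OF F \<psi> \<phi>]
      by (intro diff_chain_at) (simp_all only: Fx frechet_derivative_works[symmetric])
    then have "((snd \<theta> \<circ> F \<circ> chart_inv \<psi>) has_derivative ?B \<circ> ?A) (at (snd \<psi> x))"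
    proof (rule has_derivative_transform_within_open)
      show "open (snd \<psi> ` (fst \<psi> \<inter> U \<inter> F -` fst \<phi>))"
        using local_domain_open[OF S M F(1) c\<psi>(3) c\<phi>(3)] .
      show "snd \<psi> x \<in> snd \<psi> ` (fst \<psi> \<inter> U \<inter> F -` fst \<phi>)" using c\<psi>(2) c\<phi>(2) F(2) by auto
      fix y assume "y \<in> snd \<psi> ` (fst \<psi> \<inter> U \<inter> F -` fst \<phi>)"
      then show "(snd \<theta> \<circ> chart_inv \<phi> \<circ> (snd \<phi> \<circ> F \<circ> chart_inv \<psi>)) y = (snd \<theta> \<circ> F \<circ> chart_inv \<psi>) y"
        using chart_inv_left[OF c\<psi>(1)] chart_inv_left[OF c\<phi>(1)] by auto
    qed
    then show ?thesis
      using differential_in_chart[OF S F \<psi> \<phi> v] differential_in_chart[OF S F \<psi> \<theta> v] \<theta>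
      by (simp add: frechet_derivative_eqI tvec_of_def)
  qed (simp add: differential_def tvec_of_def Let_def)
  then have "differential S M F x v = tvec_of M (F x) \<phi> (differential S M F x v \<phi>)" by (rule ext)
  then show ?thesis using tvec_of_in_tangent_space[OF M \<phi>] by metis
qed

section \<open>Positive definite forms and the Koszul formula\<close>

text \<open>Inner products on a Euclidean space other than the standard one, such as the metric
  coefficients at a point.\<close>

definition inner_form :: "('v::euclidean_space \<Rightarrow> 'v \<Rightarrow> real) \<Rightarrow> bool" where
  "inner_form B \<longleftrightarrow> bilinear B \<and> (\<forall>a b. B a b = B b a) \<and> (\<forall>a. a \<noteq> 0 \<longrightarrow> 0 < B a a)"

lemma inner_form_eqI:
  assumes B: "inner_form B" and "\<And>c. B x c = B y c"
  shows "x = y"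
proof -
  have "B (x - y) (x - y) = 0"
    using assms bilinear_lsub[of B x y] by (simp add: inner_form_def)
  then show ?thesis
    using B unfolding inner_form_def by (metis eq_iff_diff_eq_0 less_irrefl)
qed

text \<open>Orthogonal projection onto a subspace exists for any inner product: add the vectors of a spanning
  set one at a time, as in the Gram-Schmidt process.\<close>

lemma inner_form_projection:
  assumes B: "inner_form B" and W: "subspace W"
  shows "\<exists>w\<in>W. \<forall>z\<in>W. B (x - w) z = 0"
proof -
  have bil: "bilinear B" and sym: "B a b = B b a" and pos: "a \<noteq> 0 \<Longrightarrow> 0 < B a a" for a b
    using B by (auto simp: inner_form_def)
  note rules = bilinear_ladd[OF bil] bilinear_lsub[OF bil] bilinear_lmul[OF bil]
    bilinear_radd[OF bil] bilinear_rsub[OF bil] bilinear_rmul[OF bil]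
  have main: "\<exists>w\<in>span E. \<forall>z\<in>span E. B (x - w) z = 0" if "finite E" for E x
    using that
  proof (induction E arbitrary: x)
    case empty
    then show ?case using bilinear_rzero[OF bil] by auto
  next
    case (insert e E)
    obtain e0 where e0: "e0 \<in> span E" "\<And>z. z \<in> span E \<Longrightarrow> B (e - e0) z = 0"
      using insert.IH[of e] by auto
    obtain x0 where x0: "x0 \<in> span E" "\<And>z. z \<in> span E \<Longrightarrow> B (x - x0) z = 0"
      using insert.IH[of x] by auto
    \<comment> \<open>\<open>d\<close> is the new direction made orthogonal to the old span. It may be 0, and then \<open>r\<close> is 0 too,
      as division by 0 gives 0.\<close>
    define d where "d = e - e0"
    define r where "r = B (x - x0) d / B d d"
    define w where "w = x0 + r *\<^sub>R d"
    have d_mem: "d \<in> span (insert e E)"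
      using e0(1) span_mono[of E "insert e E"] unfolding d_def
      by (intro span_diff) (auto intro: span_base)
    have wd: "B (x - w) d = 0"
    proof (cases "d = 0")
      case True then show ?thesis using bilinear_rzero[OF bil] by simp
    next
      case False
      then have "B d d \<noteq> 0" using pos by fastforce
      then show ?thesis by (simp add: w_def r_def rules diff_add_eq_diff_diff_swap)
    qed
    have wE: "B (x - w) z = 0" if "z \<in> span E" for z
      using x0(2)[OF that] e0(2)[OF that] by (simp add: w_def d_def[symmetric] rules)
    have "B (x - w) z = 0" if z: "z \<in> span (insert e E)" for z
    proof -
      obtain l where l: "z - l *\<^sub>R e \<in> span E" using z span_insert by blast
      define y where "y = (z - l *\<^sub>R e) + l *\<^sub>R e0"
      have "z = l *\<^sub>R d + y" by (simp add: y_def d_def algebra_simps)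
      moreover have "y \<in> span E"
        unfolding y_def using l e0(1) by (intro span_add span_scale)
      ultimately show ?thesis
        using wd wE[of y] by (simp add: bilinear_radd[OF bil] bilinear_rmul[OF bil])
    qed
    moreover have "x0 \<in> span (insert e E)"
      using x0(1) span_mono[OF subset_insertI] by blast
    then have "w \<in> span (insert e E)"
      unfolding w_def using d_mem by (intro span_add span_scale)
    ultimately show ?case by blast
  qed
  obtain E where E: "E \<subseteq> W" "independent E" "W \<subseteq> span E"
    using maximal_independent_subset[of W] by blast
  have "span E = W" using E W span_minimal by blast
  moreover have "finite E" using E(2) independent_imp_finite by blast
  ultimately show ?thesis using main by blast
qed

text \<open>The linear map sending \<open>z\<close> to the coordinates of \<open>B z\<close> is injective by definiteness, hence
  surjective by dimension.\<close>

lemma inner_form_riesz: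
  assumes B: "inner_form B" and L: "linear L"
  shows "\<exists>z. \<forall>c. B z c = L c"
proof -
  have bil: "bilinear B" using B by (simp add: inner_form_def)
  define A where "A x = (\<Sum>i\<in>Basis. B x i *\<^sub>R i)" for x
  have A: "A x \<bullet> i = B x i" if "i \<in> Basis" for x i
    using that by (simp add: A_def)
  have "linear A"
    by (rule linearI)
       (simp_all add: A_def bilinear_ladd[OF bil] bilinear_lmul[OF bil] scaleR_add_left
         sum.distrib scaleR_sum_right)
  moreover have "inj A"
  proof (rule injI)
    fix x y assume "A x = A y"
    then have eq: "B x i = B y i" if "i \<in> Basis" for i using A that by metis
    have "B x c = B y c" for c
      using linear_eq_on_span[of "B x" "B y" Basis c] bil eq by (simp add: bilinear_def)
    then show "x = y" using inner_form_eqI[OF B] by blast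
  qed
  ultimately have "surj A" by (rule linear_injective_imp_surjective) simp
  then obtain z where z: "A z = (\<Sum>i\<in>Basis. L i *\<^sub>R i)" by (metis surjD)
  have "B z i = L i" if "i \<in> Basis" for i
    using A[OF that, of z] that by (simp add: z)
  then have "B z c = L c" for c
    using linear_eq_on_span[of "B z" L Basis c] bil L by (simp add: bilinear_def)
  then show ?thesis by blast
qed

text \<open>The fundamental theorem of Riemannian geometry at a point, where \<open>D a b c\<close> is the derivative of
  \<open>B a b\<close> in direction \<open>c\<close>. Permuting the arguments in the compatibility condition and using the symmetry
  of \<open>\<Gamma>\<close> forces \<open>2 B (\<Gamma> a b) c = D b c a + D a c b - D a b c\<close>, and the Riesz representation
  turns this formula into a definition.\<close>

lemma koszul_exists_unique:
  fixes B :: "'v::euclidean_space \<Rightarrow> 'v \<Rightarrow> real"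
  assumes B: "inner_form B"
    and D1: "\<And>b c. linear (\<lambda>a. D a b c)" and D3: "\<And>a b. linear (D a b)"
    and D_sym: "\<And>a b c. D a b c = D b a c"
  shows "\<exists>!\<Gamma>. bilinear \<Gamma> \<and> (\<forall>a b. \<Gamma> a b = \<Gamma> b a) \<and>
     (\<forall>a b c. D a b c = B (\<Gamma> c a) b + B a (\<Gamma> c b))"
proof (rule ex_ex1I)
  have bil: "bilinear B" and sym: "B a b = B b a" for a b
    using B by (auto simp: inner_form_def)
  have D2: "linear (\<lambda>b. D a b c)" for a c using D1[of a c] D_sym by simp
  note lin = linear_add[OF D1] linear_scale[OF D1] linear_add[OF D2] linear_scale[OF D2]
    linear_add[OF D3] linear_scale[OF D3]
  define K where "K a b c = (D b c a + D a c b - D a b c) / 2" for a b c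
  have "linear (K a b)" for a b
    by (rule linearI) (simp_all add: K_def lin field_simps)
  then have "\<exists>z. \<forall>c. B z c = K a b c" for a b by (rule inner_form_riesz[OF B])
  then obtain \<Gamma> where \<Gamma>: "\<And>a b c. B (\<Gamma> a b) c = K a b c" by metis
  have \<Gamma>_sym: "\<Gamma> a b = \<Gamma> b a" for a b
    by (rule inner_form_eqI[OF B]) (simp add: \<Gamma> K_def D_sym[of a b])
  have "linear (\<Gamma> a)" for a
    by (rule linearI; rule inner_form_eqI[OF B])
       (simp_all add: \<Gamma> bilinear_ladd[OF bil] bilinear_lmul[OF bil] K_def lin field_simps)
  moreover have "(\<lambda>a. \<Gamma> a b) = \<Gamma> b" for b using \<Gamma>_sym by blast
  ultimately have "bilinear \<Gamma>" unfolding bilinear_def by simp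
  moreover have "D a b c = B (\<Gamma> c a) b + B a (\<Gamma> c b)" for a b c
    using \<Gamma>[of c a b] \<Gamma>[of c b a] sym[of a "\<Gamma> c b"] D_sym[of b a c] by (simp add: K_def field_simps)
  ultimately show "\<exists>\<Gamma>. bilinear \<Gamma> \<and> (\<forall>a b. \<Gamma> a b = \<Gamma> b a) \<and>
     (\<forall>a b c. D a b c = B (\<Gamma> c a) b + B a (\<Gamma> c b))" using \<Gamma>_sym by blast
next
  have sym: "B a b = B b a" for a b using B by (auto simp: inner_form_def)
  have K: "2 * B (\<Gamma> a b) c = D b c a + D a c b - D a b c"
    if "bilinear \<Gamma> \<and> (\<forall>a b. \<Gamma> a b = \<Gamma> b a) \<and> (\<forall>a b c. D a b c = B (\<Gamma> c a) b + B a (\<Gamma> c b))" for \<Gamma> a b c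
  proof -
    have s: "\<Gamma> b a = \<Gamma> a b" "\<Gamma> c a = \<Gamma> a c" "\<Gamma> c b = \<Gamma> b c" using that by auto
    have "D b c a = B (\<Gamma> a b) c + B b (\<Gamma> a c)" "D a c b = B (\<Gamma> b a) c + B a (\<Gamma> b c)"
      "D a b c = B (\<Gamma> c a) b + B a (\<Gamma> c b)" using that by auto
    then show ?thesis using sym[of b "\<Gamma> a c"] by (simp add: s)
  qed
  fix \<Gamma> \<Gamma>'
  assume \<Gamma>: "bilinear \<Gamma> \<and> (\<forall>a b. \<Gamma> a b = \<Gamma> b a) \<and> (\<forall>a b c. D a b c = B (\<Gamma> c a) b + B a (\<Gamma> c b))"
    and \<Gamma>': "bilinear \<Gamma>' \<and> (\<forall>a b. \<Gamma>' a b = \<Gamma>' b a) \<and> (\<forall>a b c. D a b c = B (\<Gamma>' c a) b + B a (\<Gamma>' c b))"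
  have "\<Gamma> a b = \<Gamma>' a b" for a b
  proof (rule inner_form_eqI[OF B])
    fix c show "B (\<Gamma> a b) c = B (\<Gamma>' a b) c"
      using K[OF \<Gamma>, of a b c] K[OF \<Gamma>', of a b c] by linarith
  qed
  then show "\<Gamma> = \<Gamma>'" by blast
qed

section \<open>The Levi-Civita connection in a chart\<close>

lemma local_metric_at:
  assumes "smooth_manifold M" "\<phi> \<in> charts_at M x"
  shows "local_metric M g \<phi> (snd \<phi> x) a b = g x (tvec_of M x \<phi> a) (tvec_of M x \<phi> b)"
  using chart_inv_left[OF charts_atD(1,2)[OF assms]] by (simp add: local_metric_def)

lemma metric_in_chart:
  assumes "smooth_manifold M" "\<phi> \<in> charts_at M x" "\<xi> \<in> tangent_space M x" "\<eta> \<in> tangent_space M x"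
  shows "g x \<xi> \<eta> = local_metric M g \<phi> (snd \<phi> x) (\<xi> \<phi>) (\<eta> \<phi>)"
  by (simp only: local_metric_at[OF assms(1,2)] tvec_of_component[OF assms(2,3)]
      tvec_of_component[OF assms(2,4)])

lemma local_metric_inner_form:
  assumes M: "smooth_manifold M" and g: "riemannian_metric M g" and \<phi>: "\<phi> \<in> charts_at M x"
  shows "inner_form (local_metric M g \<phi> (snd \<phi> x))" (is "inner_form ?B")
proof -
  note x = charts_atD(4)[OF M \<phi>] and T = tvec_of_in_tangent_space[OF M \<phi>]
  have sym: "?B a b = ?B b a" for a b
    using g x T unfolding riemannian_metric_def local_metric_at[OF M \<phi>] by blast
  have lc: "?B (r *\<^sub>R a + s *\<^sub>R b) c = r * ?B a c + s * ?B b c" for r s a b c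
    using g x T unfolding riemannian_metric_def local_metric_at[OF M \<phi>] tvec_of_lincomb[OF M \<phi>] by blast
  have lin: "linear (\<lambda>a. ?B a c)" for c
    using lc[of 1 _ 1] lc[of _ _ 0] by (intro linearI) simp_all
  moreover have "(\<lambda>a. ?B a c) = ?B c" for c using sym by blast
  ultimately have "bilinear ?B" unfolding bilinear_def by metis
  moreover have "0 < ?B a a" if "a \<noteq> 0" for a
  proof -
    have "tvec_of M x \<phi> a \<noteq> (\<lambda>_. 0)" using tvec_of_self[OF M \<phi>, of a] that by metis
    then show ?thesis
      using g x T unfolding riemannian_metric_def local_metric_at[OF M \<phi>] by blast
  qed
  ultimately show ?thesis using sym unfolding inner_form_def by blast
qed

lemma local_metric_has_derivative:
  assumes g: "riemannian_metric M g" and \<phi>: "\<phi> \<in> atlas M" and x: "x \<in> snd \<phi> ` fst \<phi>"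
  shows "((\<lambda>y. local_metric M g \<phi> y a b) has_derivative
     frechet_derivative (\<lambda>y. local_metric M g \<phi> y a b) (at x)) (at x)"
proof -
  have "Ck_on (Suc 0) (\<lambda>y. local_metric M g \<phi> y a b) (snd \<phi> ` fst \<phi>)"
    using g \<phi> unfolding riemannian_metric_def smooth_on_def by blast
  then have "(\<lambda>y. local_metric M g \<phi> y a b) differentiable at x" using x by auto
  then show ?thesis by (rule frechet_derivative_works[THEN iffD1])
qed

text \<open>The Koszul formula on the diagonal. Its right-hand side is what \<open>second_order_identity\<close> produces, so
  the connection enters the argument only through this formula.\<close>

lemma levi_civita_acceleration:
  assumes M: "smooth_manifold M" and g: "riemannian_metric M g" and \<phi>: "\<phi> \<in> charts_at M x"
  defines "B \<equiv> local_metric M g \<phi>"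
  shows "B (snd \<phi> x) (levi_civita M g \<phi> (snd \<phi> x) a a) c =
    frechet_derivative (\<lambda>y. B y c a) (at (snd \<phi> x)) a
    - frechet_derivative (\<lambda>y. B y a a) (at (snd \<phi> x)) c / 2"
proof -
  note c\<phi> = charts_atD[OF M \<phi>]
  let ?x = "snd \<phi> x"
  let ?S = "snd \<phi> ` fst \<phi>"
  define D where "D a b c = frechet_derivative (\<lambda>y. B y a b) (at ?x) c" for a b c
  have S: "open ?S" "?x \<in> ?S" using c\<phi> by (auto simp: is_chart_def)
  have pos: "inner_form (B y)" if "y \<in> ?S" for y
    using that local_metric_inner_form[OF M g] c\<phi>(3) unfolding B_def charts_at_def by blast
  have D: "((\<lambda>y. B y a b) has_derivative D a b) (at ?x)" for a b
    using local_metric_has_derivative[OF g c\<phi>(3) S(2), of a b] unfolding B_def D_def by simp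
  \<comment> \<open>Symmetry and linearity hold for the metric coefficients on a whole neighbourhood and pass to their
    derivatives.\<close>
  have D_sym: "D a b c = D b a c" for a b c
  proof -
    have "((\<lambda>y. B y b a) has_derivative D a b) (at ?x)"
      by (rule has_derivative_transform_within_open[OF D S]) (use pos in \<open>auto simp: inner_form_def\<close>)
    then show ?thesis using has_derivative_unique[OF D] by metis
  qed
  have D_lc: "D (r *\<^sub>R a + s *\<^sub>R a') b c = r * D a b c + s * D a' b c" for r s a a' b c
  proof -
    have "((\<lambda>y. r * B y a b + s * B y a' b) has_derivative (\<lambda>c. r * D a b c + s * D a' b c)) (at ?x)"
      by (intro has_derivative_add has_derivative_mult_right D)
    then have "((\<lambda>y. B y (r *\<^sub>R a + s *\<^sub>R a') b) has_derivative (\<lambda>c. r * D a b c + s * D a' b c)) (at ?x)"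
      by (rule has_derivative_transform_within_open[OF _ S])
         (use pos in \<open>simp add: inner_form_def bilinear_ladd bilinear_lmul\<close>)
    then show ?thesis using has_derivative_unique[OF D] by metis
  qed
  have D1: "linear (\<lambda>a. D a b c)" for b c
    using D_lc[of 1 _ 1] D_lc[of _ _ 0] by (intro linearI) simp_all
  have D3: "linear (D a b)" for a b using has_derivative_linear[OF D] .
  let ?\<Gamma> = "levi_civita M g \<phi> ?x"
  have "\<forall>a b c. D a b c = B ?x (?\<Gamma> c a) b + B ?x a (?\<Gamma> c b)" "\<forall>a b. ?\<Gamma> a b = ?\<Gamma> b a"
    using theI'[OF koszul_exists_unique[OF pos[OF S(2)] D1 D3 D_sym]]
    unfolding levi_civita_def D_def B_def by blast+
  then have "D c a a = B ?x (?\<Gamma> a c) a + B ?x c (?\<Gamma> a a)"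
     "D a a c = B ?x (?\<Gamma> a c) a + B ?x a (?\<Gamma> a c)" by metis+
  moreover have "B ?x y z = B ?x z y" for y z using pos[OF S(2)] by (simp add: inner_form_def)
  then have "B ?x a (?\<Gamma> a c) = B ?x (?\<Gamma> a c) a" "B ?x c (?\<Gamma> a a) = B ?x (?\<Gamma> a a) c" by blast+
  ultimately have "B ?x (?\<Gamma> a a) c = D c a a - D a a c / 2" by linarith
  then show ?thesis unfolding D_def .
qed

section \<open>Normal parts and the second fundamental form\<close>

lemma differential_lincomb:
  assumes S: "smooth_manifold S" and F: "Ck_map_on (Suc k) S M U F" "x \<in> U"
    and v: "v \<in> tangent_space S x" and w: "w \<in> tangent_space S x"
  shows "differential S M F x (\<lambda>\<psi>. r *\<^sub>R v \<psi> + s *\<^sub>R w \<psi>) =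
    (\<lambda>\<phi>. r *\<^sub>R differential S M F x v \<phi> + s *\<^sub>R differential S M F x w \<phi>)"
proof
  fix \<phi>
  have "x \<in> pts S" using F openin_subset unfolding Ck_map_on_def by blast
  note \<psi> = chart_at_in_charts_at[OF S this]
  show "differential S M F x (\<lambda>\<psi>. r *\<^sub>R v \<psi> + s *\<^sub>R w \<psi>) \<phi> =
    r *\<^sub>R differential S M F x v \<phi> + s *\<^sub>R differential S M F x w \<phi>"
  proof (cases "\<phi> \<in> charts_at M (F x)")
    case True
    have "linear (frechet_derivative (snd \<phi> \<circ> F \<circ> chart_inv (chart_at S x)) (at (snd (chart_at S x) x)))"
      using local_rep_differentiable[OF F \<psi> True] linear_frechet_derivative by blast
    then show ?thesis
      using True by (simp only: differential_def Let_def if_True linear_add linear_scale)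
  qed (simp add: differential_def Let_def)
qed

text \<open>The normal part is defined by description, so it has its defining properties once the orthogonal
  decomposition is known to exist uniquely. Existence is the projection lemma in a chart; uniqueness
  holds since a vector that is both tangent and normal is orthogonal to itself.\<close>

lemma normal_part_decomposition:
  assumes S: "smooth_manifold S" and M: "smooth_manifold M" and g: "riemannian_metric M g"
    and F: "Ck_map_on (Suc k) S M U F" "p \<in> U" and \<xi>: "\<xi> \<in> tangent_space M (F p)"
  defines "\<eta> \<equiv> normal_part S M g F p \<xi>"
  shows "\<eta> \<in> tangent_space M (F p)"
    and "\<And>w. w \<in> tangent_space S p \<Longrightarrow> g (F p) \<eta> (differential S M F p w) = 0"
    and "\<exists>w\<in>tangent_space S p. \<xi> = (\<lambda>\<phi>. \<eta> \<phi> + differential S M F p w \<phi>)"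
proof -
  have pS: "p \<in> pts S" using F openin_subset unfolding Ck_map_on_def by blast
  then have FM: "F p \<in> pts M"
    using F continuous_map_image_subset_topspace[of "subtopology (mtop S) U" "mtop M" F]
    unfolding Ck_map_on_def by auto
  define \<phi> where "\<phi> = chart_at M (F p)"
  have \<phi>: "\<phi> \<in> charts_at M (F p)" unfolding \<phi>_def using chart_at_in_charts_at[OF M FM] .
  let ?T = "tangent_space M (F p)"
  let ?d = "differential S M F p"
  let ?B = "local_metric M g \<phi> (snd \<phi> (F p))"
  note B = local_metric_inner_form[OF M g \<phi>]
  have bil: "bilinear ?B" using B by (simp add: inner_form_def)
  have gB: "g (F p) \<xi> \<eta> = ?B (\<xi> \<phi>) (\<eta> \<phi>)" if "\<xi> \<in> ?T" "\<eta> \<in> ?T" for \<xi> \<eta>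
    using metric_in_chart[OF M \<phi> that] .
  have dT: "?d w \<in> ?T" if "w \<in> tangent_space S p" for w
    using differential_in_tangent_space[OF S M F that] .
  note lc = differential_lincomb[OF S F] and TS = tangent_space_lincomb[OF S pS]
    and TM = tangent_space_lincomb[OF M FM]
  define N where "N \<eta> \<longleftrightarrow> \<eta> \<in> ?T \<and> (\<forall>w\<in>tangent_space S p. g (F p) \<eta> (?d w) = 0) \<and>
     (\<exists>w\<in>tangent_space S p. \<xi> = (\<lambda>\<phi>. \<eta> \<phi> + ?d w \<phi>))" for \<eta>
  define W where "W = (\<lambda>w. ?d w \<phi>) ` tangent_space S p"
  have W_lc: "r *\<^sub>R a + s *\<^sub>R b \<in> W" if ab: "a \<in> W" "b \<in> W" for r s a b
  proof -
    obtain v w where "v \<in> tangent_space S p" "w \<in> tangent_space S p" "a = ?d v \<phi>" "b = ?d w \<phi>"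
      using ab unfolding W_def by blast
    then have "r *\<^sub>R a + s *\<^sub>R b = ?d (\<lambda>\<psi>. r *\<^sub>R v \<psi> + s *\<^sub>R w \<psi>) \<phi>" "(\<lambda>\<psi>. r *\<^sub>R v \<psi> + s *\<^sub>R w \<psi>) \<in> tangent_space S p"
      using lc TS by auto
    then show ?thesis unfolding W_def by blast
  qed
  have "tvec_of S p (chart_at S p) 0 \<in> tangent_space S p"
    using tvec_of_in_tangent_space[OF S chart_at_in_charts_at[OF S pS]] .
  then obtain a0 where "a0 \<in> W" unfolding W_def by blast
  then have "subspace W"
    using W_lc[of _ _ 1 1] W_lc[of _ a0 _ 0] W_lc[of a0 a0 0 0] by (intro subspaceI) simp_all
  then obtain b where b: "b \<in> W" "\<And>z. z \<in> W \<Longrightarrow> ?B (\<xi> \<phi> - b) z = 0"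
    using inner_form_projection[OF B] by metis
  then obtain w where w: "w \<in> tangent_space S p" "b = ?d w \<phi>" unfolding W_def by blast
  have "(\<lambda>\<theta>. 1 *\<^sub>R \<xi> \<theta> + (-1) *\<^sub>R ?d w \<theta>) \<in> ?T" using TM[OF \<xi> dT[OF w(1)]] .
  then have "N (\<lambda>\<theta>. \<xi> \<theta> - ?d w \<theta>)"
    unfolding N_def using gB b(2) w dT by (auto simp: W_def intro!: bexI[OF _ w(1)])
  moreover have "\<eta>1 = \<eta>2" if n: "N \<eta>1" "N \<eta>2" for \<eta>1 \<eta>2
  proof -
    obtain w1 w2 where w: "w1 \<in> tangent_space S p" "w2 \<in> tangent_space S p"
      and eq: "\<xi> = (\<lambda>\<phi>. \<eta>1 \<phi> + ?d w1 \<phi>)" "\<xi> = (\<lambda>\<phi>. \<eta>2 \<phi> + ?d w2 \<phi>)"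
      using n unfolding N_def by blast
    have T: "\<eta>1 \<in> ?T" "\<eta>2 \<in> ?T" using n unfolding N_def by auto
    have diff: "\<eta>1 \<phi> - \<eta>2 \<phi> = ?d w2 \<phi> - ?d w1 \<phi>"
      using fun_cong[OF eq(1), of \<phi>] fun_cong[OF eq(2), of \<phi>] by (simp add: algebra_simps)
    have "?B (\<eta> \<phi>) (?d v \<phi>) = 0" if "N \<eta>" "v \<in> tangent_space S p" for \<eta> v
      using that gB dT unfolding N_def by metis
    then have "?B (\<eta>1 \<phi> - \<eta>2 \<phi>) (\<eta>1 \<phi> - \<eta>2 \<phi>) = 0"
      unfolding diff(1)[THEN arg_cong[where f = "?B (\<eta>1 \<phi> - \<eta>2 \<phi>)"]]
      using n w by (simp add: bilinear_lsub[OF bil] bilinear_rsub[OF bil])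
    then have "\<eta>1 \<phi> = \<eta>2 \<phi>"
      using B unfolding inner_form_def by (metis eq_iff_diff_eq_0 less_irrefl)
    then show ?thesis using tangent_eqI[OF \<phi> T] by blast
  qed
  ultimately have "\<exists>!\<eta>. N \<eta>" by blast
  then have "N (THE \<eta>. N \<eta>)" by (rule theI')
  moreover have "\<eta> = (THE \<eta>. N \<eta>)" unfolding \<eta>_def normal_part_def N_def by simp
  ultimately have "N \<eta>" by simp
  then show "\<eta> \<in> tangent_space M (F p)"
    and "\<And>w. w \<in> tangent_space S p \<Longrightarrow> g (F p) \<eta> (differential S M F p w) = 0"
    and "\<exists>w\<in>tangent_space S p. \<xi> = (\<lambda>\<phi>. \<eta> \<phi> + differential S M F p w \<phi>)"
    unfolding N_def by blast+
qed

text \<open>On the diagonal, the vector field with constant components \<open>v \<psi>\<close> is the velocity field of the coordinate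
  lines of \<open>\<psi>\<close>, so the second fundamental form is the normal part of the covariant acceleration
  \<open>c'' + \<Gamma>(c', c')\<close> of such a line.\<close>

lemma second_fundamental_form_in_charts:
  assumes S: "smooth_manifold S" and M: "smooth_manifold M" and F: "smooth_map S M F"
    and p: "p \<in> pts S" and v: "v \<in> tangent_space S p"
  defines "\<psi> \<equiv> chart_at S p" and "\<phi> \<equiv> chart_at M (F p)"
  defines "h \<equiv> snd \<phi> \<circ> F \<circ> chart_inv \<psi>"
  defines "h' \<equiv> (\<lambda>z. frechet_derivative h (at z) (v \<psi>))"
  shows "second_fundamental_form S M g F p v v = normal_part S M g F p (tvec_of M (F p) \<phi>
     (frechet_derivative h' (at (snd \<psi> p)) (v \<psi>)
       + levi_civita M g \<phi> (snd \<phi> (F p)) (h' (snd \<psi> p)) (h' (snd \<psi> p))))"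
proof -
  have F1: "Ck_map_on (Suc 0) S M (pts S) F" and F2: "Ck_map_on (Suc (Suc 0)) S M (pts S) F"
    using F unfolding smooth_map_def by blast+
  have FM: "F p \<in> pts M"
    using F1 p continuous_map_image_subset_topspace[of "subtopology (mtop S) (pts S)" "mtop M" F]
    unfolding Ck_map_on_def by auto
  have \<psi>: "\<psi> \<in> charts_at S p" and \<phi>: "\<phi> \<in> charts_at M (F p)"
    unfolding \<psi>_def \<phi>_def
    using chart_at_in_charts_at[OF S p] chart_at_in_charts_at[OF M FM] .
  note c\<psi> = charts_atD[OF S \<psi>] and c\<phi> = charts_atD[OF M \<phi>]
  let ?W = "snd \<psi> ` (fst \<psi> \<inter> pts S \<inter> F -` fst \<phi>)"
  let ?Y = "\<lambda>x. differential S M F x (tvec_of S x \<psi> (v \<psi>))"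
  have W: "open ?W" "snd \<psi> p \<in> ?W"
    using local_domain_open[OF S M F1 c\<psi>(3) c\<phi>(3)] c\<psi>(2) c\<phi>(2) p by auto
  have Y: "h' z = ?Y (chart_inv \<psi> z) \<phi>" if z: "z \<in> ?W" for z
  proof -
    define x where "x = chart_inv \<psi> z"
    have x: "x \<in> fst \<psi>" "x \<in> pts S" "F x \<in> fst \<phi>" "snd \<psi> x = z"
      using z chart_inv_left[OF c\<psi>(1)] unfolding x_def by auto
    have ch: "\<psi> \<in> charts_at S x" "\<phi> \<in> charts_at M (F x)"
      using x c\<psi>(3) c\<phi>(3) by (auto simp: charts_at_def)
    show ?thesis
      using differential_in_chart[OF S F1 x(2) ch tvec_of_in_tangent_space[OF S ch(1)]]
      by (simp add: x(4) x_def[symmetric] tvec_of_self[OF S ch(1)] h'_def h_def)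
  qed
  have dv: "differential S M F p v \<phi> = h' (snd \<psi> p)"
    using differential_in_chart[OF S F1 p \<psi> \<phi> v] by (simp add: h'_def h_def)
  have "Ck_on (Suc (Suc 0)) h ?W"
    using F2 c\<psi>(3) c\<phi>(3) unfolding Ck_map_on_def h_def by blast
  then have "h' differentiable at (snd \<psi> p)" using W(2) unfolding h'_def Ck_on.simps by blast
  then have "(h' has_derivative frechet_derivative h' (at (snd \<psi> p))) (at (snd \<psi> p))"
    by (rule frechet_derivative_works[THEN iffD1])
  then have "((\<lambda>z. ?Y (chart_inv \<psi> z) \<phi>) has_derivative frechet_derivative h' (at (snd \<psi> p))) (at (snd \<psi> p))"
    by (rule has_derivative_transform_within_open[OF _ W]) (rule Y)
  then have dY: "frechet_derivative (\<lambda>z. ?Y (chart_inv \<psi> z) \<phi>) (at (snd \<psi> p)) = frechet_derivative h' (at (snd \<psi> p))"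
    by (rule frechet_derivative_eqI)
  have Yp: "?Y p \<phi> = h' (snd \<psi> p)"
    using Y[OF W(2)] chart_inv_left[OF c\<psi>(1,2)] by simp
  have "cov_deriv_along S M g F p v ?Y = tvec_of M (F p) \<phi>
     (frechet_derivative h' (at (snd \<psi> p)) (v \<psi>)
       + levi_civita M g \<phi> (snd \<phi> (F p)) (h' (snd \<psi> p)) (h' (snd \<psi> p)))"
    unfolding cov_deriv_along_def Let_def \<psi>_def[symmetric] \<phi>_def[symmetric]
    by (simp only: dY dv Yp)
  then show ?thesis
    unfolding second_fundamental_form_def Let_def \<psi>_def[symmetric] by simp
qed

section \<open>Euclidean space as a Riemannian manifold\<close>

abbreviation std_chart :: "(real^'q, 'q::finite) chart" where
  "std_chart \<equiv> (UNIV, id)"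

lemma charts_at_euclidean: "charts_at euclidean_mfd x = {std_chart}"
  by (auto simp: charts_at_def euclidean_mfd_def)

lemma chart_at_euclidean: "chart_at euclidean_mfd x = std_chart"
  unfolding chart_at_def charts_at_euclidean by simp

lemma chart_inv_euclidean: "chart_inv std_chart = id"
  unfolding chart_inv_def by simp

lemma Ck_on_const: "Ck_on k (\<lambda>x. c) S"
  by (induction k arbitrary: c) simp_all

lemma smooth_on_id: "smooth_on id S"
proof -
  have "id differentiable at x" for x :: 'a
    using has_derivative_id differentiableI by blast
  then have "Ck_on k (id :: 'a \<Rightarrow> 'a) S" for k
    by (cases k) (simp_all add: Ck_on_const continuous_on_id')
  then show ?thesis by (simp add: smooth_on_def)
qed

text \<open>Together with \<open>flat_metric_riemannian\<close> this lets the lemmas on Riemannian manifolds apply to the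
  target of \<open>f\<close> and \<open>u\<close>.\<close>

lemma euclidean_mfd_smooth: "smooth_manifold euclidean_mfd"
proof -
  have "Hausdorff_space (euclidean :: (real^'q) topology)"
    by (rule Hausdorff_space_euclidean)
  moreover have "second_countable (euclidean :: (real^'q) topology)"
  proof -
    obtain \<B> :: "(real^'q) set set" where "countable \<B>" "topological_basis \<B>"
      using ex_countable_basis by blast
    then show ?thesis
      unfolding second_countable_def open_openin[symmetric]
      by (meson topological_basisE topological_basis_open)
  qed
  ultimately show ?thesis
    by (simp add: smooth_manifold_def euclidean_mfd_def is_chart_def smooth_on_id chart_inv_euclidean)
qed

lemma tangent_space_euclidean_eqI:
  assumes "\<xi> \<in> tangent_space euclidean_mfd x" "\<xi> std_chart = 0"
  shows "\<xi> = (\<lambda>_. 0)"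
proof
  fix \<phi>
  have "\<xi> \<phi> = 0" if "\<phi> \<noteq> std_chart"
    using assms(1) that unfolding tangent_space_def charts_at_euclidean by blast
  then show "\<xi> \<phi> = 0" using assms(2) by blast
qed

lemma local_flat_metric: "local_metric euclidean_mfd flat_metric std_chart x a b = a \<bullet> b"
proof -
  have "tvec_of euclidean_mfd y std_chart c std_chart = c" for y c :: "real^'a"
    by (rule tvec_of_self[OF euclidean_mfd_smooth]) (simp add: charts_at_euclidean)
  then show ?thesis unfolding local_metric_def flat_metric_def Let_def by simp
qed

lemma flat_metric_riemannian:
  "riemannian_metric euclidean_mfd (flat_metric :: (real^'q::finite, 'q) metric_field)"
proof -
  have "\<forall>\<phi>\<in>atlas (euclidean_mfd :: (real^'q, 'q) mfd). \<forall>a b.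
     smooth_on (\<lambda>x. local_metric euclidean_mfd flat_metric \<phi> x a b) (snd \<phi> ` fst \<phi>)"
    by (simp add: euclidean_mfd_def[THEN arg_cong, of atlas] local_flat_metric smooth_on_def Ck_on_const)
  moreover have pos: "0 < flat_metric p \<xi> \<xi>"
    if "\<xi> \<in> tangent_space euclidean_mfd p" "\<xi> \<noteq> (\<lambda>_. 0)" for \<xi> :: "(real^'q, 'q) tvec" and p
    using tangent_space_euclidean_eqI[OF that(1)] that(2) unfolding flat_metric_def by auto
  moreover have sym: "flat_metric p \<xi> \<eta> = flat_metric p \<eta> \<xi>" for \<xi> \<eta> :: "(real^'q, 'q) tvec" and p
    unfolding flat_metric_def by (rule inner_commute)
  moreover have lin: "flat_metric p (\<lambda>\<phi>. a *\<^sub>R \<xi> \<phi> + b *\<^sub>R \<eta> \<phi>) \<zeta> = a * flat_metric p \<xi> \<zeta> + b * flat_metric p \<eta> \<zeta>"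
    for \<xi> \<eta> \<zeta> :: "(real^'q, 'q) tvec" and p a b
    by (simp add: flat_metric_def inner_add_left)
  ultimately show ?thesis
    unfolding riemannian_metric_def by (intro conjI ballI allI impI lin sym pos) blast+
qed

lemma levi_civita_flat: "levi_civita euclidean_mfd flat_metric std_chart x a a = 0"
proof -
  have "levi_civita euclidean_mfd flat_metric std_chart x a a \<bullet> c = 0 \<bullet> c" for c
    using levi_civita_acceleration[OF euclidean_mfd_smooth flat_metric_riemannian, of std_chart x a c]
    by (simp add: charts_at_euclidean local_flat_metric)
  then show ?thesis using vector_eq_rdot by blast
qed

section \<open>Isometric extensions\<close>

lemma Ck_on_subset: "Ck_on k f S \<Longrightarrow> T \<subseteq> S \<Longrightarrow> Ck_on k f T"
  by (induction k arbitrary: f) (auto intro: continuous_on_subset)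

lemma derivative_along_line:
  assumes "h differentiable at (z + t *\<^sub>R w)"
  shows "((\<lambda>t. h (z + t *\<^sub>R w)) has_vector_derivative frechet_derivative h (at (z + t *\<^sub>R w)) w) (at t)"
proof -
  have h: "(h has_derivative frechet_derivative h (at (z + t *\<^sub>R w))) (at (z + t *\<^sub>R w))"
    using assms by (rule frechet_derivative_works[THEN iffD1])
  have "((\<lambda>t. z + t *\<^sub>R w) has_derivative (\<lambda>s. s *\<^sub>R w)) (at t)"
    by (auto intro!: derivative_eq_intros)
  from has_derivative_compose[OF this h] show ?thesis
    by (simp add: has_vector_derivative_def linear_scale[OF has_derivative_linear[OF h]])
qed

text \<open>What an isometric extension \<open>u\<close> of \<open>f\<close> tells about \<open>f\<close> at \<open>p\<close>, read in charts \<open>\<psi>\<close> of the submanifold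
  and \<open>\<phi>\<close> of \<open>M\<close>: \<open>h\<close> is the inclusion, \<open>k\<close> is \<open>f\<close>, and \<open>du\<close> is the differential of \<open>u\<close>. The last
  equation is \<open>second_order_identity\<close> for the line \<open>t \<mapsto> h (\<psi> p + t w)\<close>, whose image under \<open>u\<close>
  is smooth because it equals that of \<open>f\<close>.\<close>

lemma isometric_extension_second_order:
  fixes M :: "('a, 'n::finite) mfd" and S :: "('a, 'm::finite) mfd" and f u :: "'a \<Rightarrow> real^'q::finite"
  assumes M: "smooth_manifold M" and g: "riemannian_metric M g" and S: "smooth_manifold S"
    and incl: "smooth_map S M id" and top: "mtop S = subtopology (mtop M) (pts S)"
    and f: "smooth_map S euclidean_mfd f"
    and U: "openin (mtop M) U" "p \<in> U" and p: "p \<in> pts S"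
    and u: "Ck_map_on 1 M euclidean_mfd U u"
    and iso: "isometric_on M g euclidean_mfd flat_metric U u"
    and agree: "\<And>x. x \<in> pts S \<inter> U \<Longrightarrow> u x = f x"
    and \<psi>: "\<psi> \<in> charts_at S p" and \<phi>: "\<phi> \<in> charts_at M p"
  defines "h \<equiv> snd \<phi> \<circ> id \<circ> chart_inv \<psi>"
    and "k \<equiv> snd std_chart \<circ> f \<circ> chart_inv \<psi>"
    and "du \<equiv> frechet_derivative (snd std_chart \<circ> u \<circ> chart_inv \<phi>) (at (snd \<phi> p))"
  shows "du a \<bullet> du b = local_metric M g \<phi> (snd \<phi> p) a b"
    and "frechet_derivative k (at (snd \<psi> p)) w = du (frechet_derivative h (at (snd \<psi> p)) w)"
    and "du n \<bullet> frechet_derivative (\<lambda>z. frechet_derivative k (at z) w) (at (snd \<psi> p)) w =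
      local_metric M g \<phi> (snd \<phi> p) n
       (frechet_derivative (\<lambda>z. frechet_derivative h (at z) w) (at (snd \<psi> p)) w
        + levi_civita M g \<phi> (snd \<phi> p) (frechet_derivative h (at (snd \<psi> p)) w)
             (frechet_derivative h (at (snd \<psi> p)) w))"
proof -
  note c\<psi> = charts_atD[OF S \<psi>] and c\<phi> = charts_atD[OF M \<phi>]
  define u\<phi> where "u\<phi> = snd std_chart \<circ> u \<circ> chart_inv \<phi>"
  define u' where "u' x = frechet_derivative u\<phi> (at x)" for x
  define V where "V = snd \<phi> ` (fst \<phi> \<inter> U)"
  define W where "W = snd \<psi> ` (fst \<psi> \<inter> (pts S \<inter> (U \<inter> fst \<phi>)))"
  define G where "G x a b = local_metric M g \<phi> x a b" for x a b
  define G' where "G' a b x = frechet_derivative (\<lambda>y. G y a b) (at x)" for a b x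
  let ?z0 = "snd \<psi> p" and ?x0 = "snd \<phi> p"
  have E: "std_chart \<in> atlas euclidean_mfd" by (simp add: euclidean_mfd_def)
  have V: "open V" "?x0 \<in> V" "V \<subseteq> snd \<phi> ` fst \<phi>"
    unfolding V_def using open_chart_image[OF c\<phi>(1) U(1)] c\<phi>(2) U(2) by auto
  have "openin (mtop M) (U \<inter> fst \<phi>)" using U(1) c\<phi>(1) by (auto simp: is_chart_def)
  then have "openin (mtop S) (pts S \<inter> (U \<inter> fst \<phi>))"
    using openin_subtopology_Int2[of "mtop M" _ "pts S"] by (simp only: top[symmetric])
  then have W: "open W" "?z0 \<in> W"
    unfolding W_def using open_chart_image[OF c\<psi>(1)] c\<psi>(2) c\<phi>(2) p U(2) by auto
  have u1: "Ck_on (Suc 0) u\<phi> V"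
  proof -
    have "Ck_on 1 u\<phi> (snd \<phi> ` (fst \<phi> \<inter> U \<inter> u -` fst std_chart))"
      using u c\<phi>(3) E unfolding Ck_map_on_def u\<phi>_def by blast
    then show ?thesis by (simp add: V_def)
  qed
  have u': "(u\<phi> has_derivative u' x) (at x)" if "x \<in> V" for x
    unfolding u'_def using u1 that by (intro frechet_derivative_works[THEN iffD1]) simp
  have u'_cont: "continuous_on V (\<lambda>x. u' x a)" for a using u1 by (simp add: u'_def)
  \<comment> \<open>The metric coefficients are the Gram form of the extension; this is where isometry is used off
    the submanifold, and it makes the Gram form differentiable.\<close>
  have G: "u' x a \<bullet> u' x b = G x a b" if x: "x \<in> V" for x a b
  proof -
    define q where "q = chart_inv \<phi> x"
    have q: "q \<in> fst \<phi>" "q \<in> U" "snd \<phi> q = x"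
      using x chart_inv_left[OF c\<phi>(1)] unfolding q_def V_def by auto
    have \<phi>q: "\<phi> \<in> charts_at M q" using q c\<phi>(3) by (simp add: charts_at_def)
    have T: "tvec_of M q \<phi> c \<in> tangent_space M q" for c by (rule tvec_of_in_tangent_space[OF M \<phi>q])
    have "differential M euclidean_mfd u q (tvec_of M q \<phi> c) std_chart = u' x c" for c
      using differential_in_chart[OF M u[unfolded One_nat_def] q(2) \<phi>q _ T, of std_chart c]
      by (simp add: charts_at_euclidean u'_def u\<phi>_def q(3) tvec_of_self[OF M \<phi>q])
    moreover have "pullback_metric M euclidean_mfd flat_metric u q (tvec_of M q \<phi> a) (tvec_of M q \<phi> b)
        = g q (tvec_of M q \<phi> a) (tvec_of M q \<phi> b)"
      using iso q(2) T unfolding isometric_on_def by blast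
    ultimately show ?thesis
      using local_metric_at[OF M \<phi>q, of g a b]
      by (simp add: pullback_metric_def flat_metric_def G_def q(3))
  qed
  have G': "((\<lambda>y. u' y a \<bullet> u' y b) has_derivative G' a b x) (at x)" if x: "x \<in> V" for a b x
  proof -
    have "((\<lambda>y. G y a b) has_derivative G' a b x) (at x)"
      unfolding G'_def G_def using local_metric_has_derivative[OF g c\<phi>(3)] V(3) x by blast
    then show ?thesis by (rule has_derivative_transform_within_open[OF _ V(1) x]) (simp add: G)
  qed
  have G'_cont: "continuous_on V (\<lambda>x. G' a b x e)" for a b e
  proof -
    have "Ck_on (Suc 0) (\<lambda>y. G y a b) (snd \<phi> ` fst \<phi>)"
      using g c\<phi>(3) unfolding riemannian_metric_def smooth_on_def G_def by blast
    then have "continuous_on (snd \<phi> ` fst \<phi>) (\<lambda>x. G' a b x e)"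
      unfolding G'_def Ck_on.simps by blast
    then show ?thesis by (rule continuous_on_subset[OF _ V(3)])
  qed
  have uh: "h z \<in> V" "u\<phi> (h z) = k z" if z: "z \<in> W" for z
  proof -
    define x where "x = chart_inv \<psi> z"
    have x: "x \<in> pts S" "x \<in> U" "x \<in> fst \<phi>"
      using z chart_inv_left[OF c\<psi>(1)] unfolding x_def W_def by auto
    have hz: "h z = snd \<phi> x" by (simp add: h_def x_def)
    show "h z \<in> V" unfolding hz V_def using x by blast
    show "u\<phi> (h z) = k z"
      using agree x chart_inv_left[OF c\<phi>(1) x(3)] by (simp add: hz u\<phi>_def k_def x_def)
  qed
  have h2: "Ck_on (Suc (Suc 0)) h W"
  proof (rule Ck_on_subset)
    show "Ck_on (Suc (Suc 0)) h (snd \<psi> ` (fst \<psi> \<inter> pts S \<inter> id -` fst \<phi>))"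
      using incl c\<psi>(3) c\<phi>(3) unfolding smooth_map_def Ck_map_on_def h_def by blast
  qed (auto simp: W_def)
  have k2: "Ck_on (Suc (Suc 0)) k W"
  proof (rule Ck_on_subset)
    show "Ck_on (Suc (Suc 0)) k (snd \<psi> ` (fst \<psi> \<inter> pts S \<inter> f -` fst std_chart))"
      using f c\<psi>(3) E unfolding smooth_map_def Ck_map_on_def k_def by blast
  qed (auto simp: W_def)
  have hp: "h ?z0 = ?x0" using chart_inv_left[OF c\<psi>(1,2)] by (simp add: h_def)
  have du: "du = u' ?x0" by (simp add: du_def u'_def u\<phi>_def)
  show "du a \<bullet> du b = local_metric M g \<phi> (snd \<phi> p) a b" for a b
    using G[OF V(2)] by (simp add: du G_def)
  show "frechet_derivative k (at ?z0) w = du (frechet_derivative h (at ?z0) w)" for w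
  proof -
    have "(h has_derivative frechet_derivative h (at ?z0)) (at ?z0)"
      using h2 W(2) by (intro frechet_derivative_works[THEN iffD1]) simp
    from has_derivative_compose[OF this, of u\<phi> "u' ?x0"] u'[OF V(2)]
    have "((\<lambda>z. u\<phi> (h z)) has_derivative (\<lambda>w. du (frechet_derivative h (at ?z0) w))) (at ?z0)"
      by (simp add: hp du)
    then have "(k has_derivative (\<lambda>w. du (frechet_derivative h (at ?z0) w))) (at ?z0)"
      by (rule has_derivative_transform_within_open[OF _ W]) (rule uh(2))
    then show ?thesis by (simp add: frechet_derivative_eqI)
  qed
  show "du n \<bullet> frechet_derivative (\<lambda>z. frechet_derivative k (at z) w) (at ?z0) w =
      local_metric M g \<phi> ?x0 n
       (frechet_derivative (\<lambda>z. frechet_derivative h (at z) w) (at ?z0) w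
        + levi_civita M g \<phi> ?x0 (frechet_derivative h (at ?z0) w) (frechet_derivative h (at ?z0) w))"
    for n w
  proof -
    let ?l = "\<lambda>t. ?z0 + t *\<^sub>R w"
    let ?h1 = "\<lambda>z. frechet_derivative h (at z) w" and ?k1 = "\<lambda>z. frechet_derivative k (at z) w"
    let ?h2 = "\<lambda>z. frechet_derivative ?h1 (at z) w" and ?k2 = "\<lambda>z. frechet_derivative ?k1 (at z) w"
    have l: "isCont ?l 0" by (intro continuous_intros)
    then have "(?l \<longlongrightarrow> ?z0) (nhds 0)" 
      using tendsto_at_iff_tendsto_nhds[of ?l 0] by (simp add: isCont_def)
    then have "eventually (\<lambda>t. ?l t \<in> W) (nhds 0)" using topological_tendstoD W by blast
    then obtain r where r: "0 < r" "\<And>t. \<bar>t\<bar> < r \<Longrightarrow> ?l t \<in> W"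
      unfolding eventually_nhds_metric by (auto simp: dist_real_def)
    have "isCont (\<lambda>t. ?k2 (?l t)) 0"
    proof (rule continuous_at_compose[unfolded o_def, OF l])
      have "continuous_on W ?k2" using k2 by simp
      then show "isCont ?k2 (?l 0)" using W by (simp add: continuous_on_eq_continuous_at)
    qed
    then have "u' (h (?l 0)) n \<bullet> ?k2 (?l 0) =
      u' (h (?l 0)) n \<bullet> u' (h (?l 0)) (?h2 (?l 0)) + G' n (?h1 (?l 0)) (h (?l 0)) (?h1 (?l 0))
      - G' (?h1 (?l 0)) (?h1 (?l 0)) (h (?l 0)) n / 2"
      by (intro second_order_identity[where u = u\<phi> and V = V and r = r and c = "\<lambda>t. h (?l t)" and
           u' = u' and G' = G' and ?c1.0 = "\<lambda>t. ?h1 (?l t)" and k = "\<lambda>t. k (?l t)" and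
           ?k1.0 = "\<lambda>t. ?k1 (?l t)" and ?k2.0 = "\<lambda>t. ?k2 (?l t)" and ?c2.0 = "?h2 (?l 0)" and X = n]
           V(1) r(1) uh r(2) u' u'_cont G' G'_cont derivative_along_line)
         (use h2 k2 r W(2) in auto)
    then have "u' ?x0 n \<bullet> ?k2 ?z0 = G ?x0 n (?h2 ?z0) + G' n (?h1 ?z0) ?x0 (?h1 ?z0)
      - G' (?h1 ?z0) (?h1 ?z0) ?x0 n / 2"
      by (simp add: hp G[OF V(2)])
    moreover have "G ?x0 (levi_civita M g \<phi> ?x0 (?h1 ?z0) (?h1 ?z0)) n =
        G' n (?h1 ?z0) ?x0 (?h1 ?z0) - G' (?h1 ?z0) (?h1 ?z0) ?x0 n / 2"
      using levi_civita_acceleration[OF M g \<phi>] unfolding G_def G'_def .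
    moreover have "G ?x0 n (y + z) = G ?x0 n y + G ?x0 z n" for y z
      using local_metric_inner_form[OF M g \<phi>] unfolding inner_form_def G_def
      by (metis bilinear_radd)
    ultimately show ?thesis unfolding du G_def by simp
  qed
qed

theorem proposition2p3:
  fixes M :: "('a, 'n::finite) mfd" and g :: "('a, 'n) metric_field"
    and \<Sigma> :: "('a, 'm::finite) mfd"
    and f :: "'a \<Rightarrow> real^'q::finite"
    and p :: 'a and \<nu> :: "('a, 'n) tvec"
  assumes "smooth_manifold M" and "riemannian_metric M g" and "CARD('n) \<ge> 2"
    and "smooth_hypersurface M \<Sigma>"
    and "CARD('q) \<ge> CARD('n) + 1"
    and "smooth_immersion \<Sigma> euclidean_mfd f"
    and "isometric_on \<Sigma> (pullback_metric \<Sigma> M g id) euclidean_mfd flat_metric (pts \<Sigma>) f"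
    and "p \<in> pts \<Sigma>"
    and "unit_normal M g \<Sigma> p \<nu>"
    and "\<exists>v\<in>tangent_space \<Sigma> p. metric_norm (pullback_metric \<Sigma> M g id) p v = 1 \<and>
           \<bar>scalar_second_form M g \<Sigma> p \<nu> v v\<bar> >
           metric_norm flat_metric (f p)
             (second_fundamental_form \<Sigma> euclidean_mfd flat_metric f p v v)"
  shows "\<not> (\<exists>U u. openin (mtop M) U \<and> p \<in> U \<and>
           Ck_map_on 1 M euclidean_mfd U u \<and>
           isometric_on M g euclidean_mfd flat_metric U u \<and>
           (\<forall>x \<in> pts \<Sigma> \<inter> U. u x = f x))"
proof
  assume "\<exists>U u. openin (mtop M) U \<and> p \<in> U \<and>
           Ck_map_on 1 M euclidean_mfd U u \<and>
           isometric_on M g euclidean_mfd flat_metric U u \<and>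
           (\<forall>x \<in> pts \<Sigma> \<inter> U. u x = f x)"
  then obtain U u where U: "openin (mtop M) U" "p \<in> U" and u: "Ck_map_on 1 M euclidean_mfd U u"
    and iso: "isometric_on M g euclidean_mfd flat_metric U u"
    and agree: "\<And>x. x \<in> pts \<Sigma> \<inter> U \<Longrightarrow> u x = f x" by blast
  note M = assms(1) and g = assms(2) and p = assms(8)
  have S: "smooth_manifold \<Sigma>" and incl: "smooth_map \<Sigma> M id" and pM: "p \<in> pts M"
    and top: "mtop \<Sigma> = subtopology (mtop M) (pts \<Sigma>)"
    using assms(4) p unfolding smooth_hypersurface_def smooth_immersion_def by blast+
  have f: "smooth_map \<Sigma> euclidean_mfd f" using assms(6) unfolding smooth_immersion_def by blast
  have incl1: "Ck_map_on (Suc 0) \<Sigma> M (pts \<Sigma>) id" and f1: "Ck_map_on (Suc 0) \<Sigma> euclidean_mfd (pts \<Sigma>) f"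
    using incl f unfolding smooth_map_def by blast+
  obtain v where v: "v \<in> tangent_space \<Sigma> p"
    and gt: "\<bar>scalar_second_form M g \<Sigma> p \<nu> v v\<bar> >
           metric_norm flat_metric (f p) (second_fundamental_form \<Sigma> euclidean_mfd flat_metric f p v v)"
    using assms(10) by blast
  have \<nu>: "\<nu> \<in> tangent_space M p" "g p \<nu> \<nu> = 1"
    "\<And>w. w \<in> tangent_space \<Sigma> p \<Longrightarrow> g p \<nu> (differential \<Sigma> M id p w) = 0"
    using assms(9) unfolding unit_normal_def by blast+
  define \<psi> where "\<psi> = chart_at \<Sigma> p"
  define \<phi> where "\<phi> = chart_at M p"
  have \<psi>: "\<psi> \<in> charts_at \<Sigma> p" and \<phi>: "\<phi> \<in> charts_at M p" and \<phi>': "\<phi> \<in> charts_at M (id p)"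
    unfolding \<psi>_def \<phi>_def
    using chart_at_in_charts_at[OF S p] chart_at_in_charts_at[OF M pM] by simp_all
  have id_p: "id p = p" by simp
  have E: "std_chart \<in> charts_at euclidean_mfd (f p)" by (simp add: charts_at_euclidean)
  let ?h = "snd \<phi> \<circ> id \<circ> chart_inv \<psi>" and ?k = "snd std_chart \<circ> f \<circ> chart_inv \<psi>"
  define w where "w = v \<psi>"
  define h1 where "h1 = frechet_derivative ?h (at (snd \<psi> p))"
  define k1 where "k1 = frechet_derivative ?k (at (snd \<psi> p))"
  define acc where "acc = frechet_derivative (\<lambda>z. frechet_derivative ?h (at z) w) (at (snd \<psi> p)) w
     + levi_civita M g \<phi> (snd \<phi> p) (h1 w) (h1 w)"
  define k2 where "k2 = frechet_derivative (\<lambda>z. frechet_derivative ?k (at z) w) (at (snd \<psi> p)) w"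
  define du where "du = frechet_derivative (snd std_chart \<circ> u \<circ> chart_inv \<phi>) (at (snd \<phi> p))"
  define B where "B = local_metric M g \<phi> (snd \<phi> p)"
  note ext = isometric_extension_second_order[OF M g S incl top f U p u iso agree \<psi> \<phi>]
  have du_iso: "du a \<bullet> du b = B a b" for a b using ext(1) unfolding du_def B_def .
  have k1_h1: "k1 b = du (h1 b)" for b using ext(2) unfolding du_def k1_def h1_def .
  have du_k2: "du n \<bullet> k2 = B n acc" for n
    using ext(3) unfolding du_def k2_def acc_def h1_def B_def .
  have gB: "g p \<xi> \<eta> = B (\<xi> \<phi>) (\<eta> \<phi>)" if "\<xi> \<in> tangent_space M p" "\<eta> \<in> tangent_space M p" for \<xi> \<eta>
    using metric_in_chart[OF M \<phi> that] unfolding B_def .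
  have bil: "bilinear B" using local_metric_inner_form[OF M g \<phi>] by (simp add: inner_form_def B_def)
  have d_incl: "differential \<Sigma> M id p a \<in> tangent_space M p" "differential \<Sigma> M id p a \<phi> = h1 (a \<psi>)"
    if "a \<in> tangent_space \<Sigma> p" for a
    using differential_in_tangent_space[OF S M incl1 p that] differential_in_chart[OF S incl1 p \<psi> \<phi>' that]
    unfolding id_p h1_def .
  \<comment> \<open>With \<open>du_iso\<close> and \<open>k1_h1\<close> this makes \<open>du \<nu>\<close> orthogonal to \<open>df(T\<^sub>p\<Sigma>)\<close>.\<close>
  have orth: "B (\<nu> \<phi>) (h1 (a \<psi>)) = 0" if "a \<in> tangent_space \<Sigma> p" for a
    using \<nu>(3)[OF that] gB[OF \<nu>(1) d_incl(1)[OF that]] d_incl(2)[OF that] by simp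

  \<comment> \<open>The tangential part of the acceleration that the second fundamental form discards is orthogonal
    to \<open>\<nu>\<close>.\<close>
  have h_eq: "scalar_second_form M g \<Sigma> p \<nu> v v = B (\<nu> \<phi>) acc"
  proof -
    let ?\<xi> = "tvec_of M p \<phi> acc"
    let ?\<eta> = "normal_part \<Sigma> M g id p ?\<xi>"
    have \<xi>: "?\<xi> \<in> tangent_space M (id p)" using tvec_of_in_tangent_space[OF M \<phi>] by simp
    note \<eta> = normal_part_decomposition[OF S M g incl1 p \<xi>]
    obtain a where a: "a \<in> tangent_space \<Sigma> p" "?\<xi> = (\<lambda>\<phi>. ?\<eta> \<phi> + differential \<Sigma> M id p a \<phi>)"
      using \<eta>(3) by blast
    have "acc = ?\<eta> \<phi> + h1 (a \<psi>)"
      using fun_cong[OF a(2), of \<phi>] d_incl(2)[OF a(1)] by (simp add: tvec_of_self[OF M \<phi>])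
    from arg_cong[OF this, of "B (\<nu> \<phi>)"] have "B (\<nu> \<phi>) acc = B (\<nu> \<phi>) (?\<eta> \<phi>)"
      unfolding bilinear_radd[OF bil] orth[OF a(1)] add_0_right .
    also have "\<dots> = g p \<nu> ?\<eta>" 
      using gB[OF \<nu>(1) \<eta>(1)[unfolded id_p]] by (rule sym)
    also have "?\<eta> = second_fundamental_form \<Sigma> M g id p v v"
      using second_fundamental_form_in_charts[OF S M incl p v, of g]
      unfolding id_p \<psi>_def[symmetric] \<phi>_def[symmetric] w_def[symmetric] h1_def[symmetric]
        acc_def[symmetric] by (rule sym)
    finally show ?thesis unfolding scalar_second_form_def by (rule sym)
  qed

  define \<eta> where "\<eta> = second_fundamental_form \<Sigma> euclidean_mfd flat_metric f p v v"
  have "\<exists>a\<in>tangent_space \<Sigma> p. k2 = \<eta> std_chart + k1 (a \<psi>)"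
  proof -
    let ?\<xi> = "tvec_of euclidean_mfd (f p) std_chart k2"
    have \<eta>_eq: "\<eta> = normal_part \<Sigma> euclidean_mfd flat_metric f p ?\<xi>"
      using second_fundamental_form_in_charts[OF S euclidean_mfd_smooth f p v, of flat_metric]
      unfolding chart_at_euclidean levi_civita_flat \<psi>_def[symmetric] w_def[symmetric] k2_def[symmetric]
        \<eta>_def[symmetric] by simp
    have \<xi>: "?\<xi> \<in> tangent_space euclidean_mfd (f p)"
      by (rule tvec_of_in_tangent_space[OF euclidean_mfd_smooth E])
    obtain a where a: "a \<in> tangent_space \<Sigma> p"
      "?\<xi> = (\<lambda>\<phi>. \<eta> \<phi> + differential \<Sigma> euclidean_mfd f p a \<phi>)"
      using normal_part_decomposition(3)[OF S euclidean_mfd_smooth flat_metric_riemannian f1 p \<xi>]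
      unfolding \<eta>_eq[symmetric] by blast
    from fun_cong[OF a(2), of std_chart] have "k2 = \<eta> std_chart + k1 (a \<psi>)"
      unfolding tvec_of_self[OF euclidean_mfd_smooth E] differential_in_chart[OF S f1 p \<psi> E a(1)]
        k1_def .
    then show ?thesis using a(1) by blast
  qed
  then obtain a where a: "a \<in> tangent_space \<Sigma> p" "k2 = \<eta> std_chart + k1 (a \<psi>)" by blast
  have "B (\<nu> \<phi>) acc = du (\<nu> \<phi>) \<bullet> \<eta> std_chart"
    using du_k2[of "\<nu> \<phi>"] orth[OF a(1)] by (simp add: a(2) inner_add_right k1_h1 du_iso)
  moreover have "norm (du (\<nu> \<phi>)) = 1"
    using gB[OF \<nu>(1) \<nu>(1)] \<nu>(2) by (simp add: norm_eq_sqrt_inner du_iso)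
  ultimately have "\<bar>scalar_second_form M g \<Sigma> p \<nu> v v\<bar> \<le> norm (\<eta> std_chart)"
    using Cauchy_Schwarz_ineq2[of "du (\<nu> \<phi>)" "\<eta> std_chart"] by (simp add: h_eq)
  also have "\<dots> = metric_norm flat_metric (f p) \<eta>"
    by (simp add: metric_norm_def flat_metric_def norm_eq_sqrt_inner)
  finally show False using gt unfolding \<eta>_def by linarith
qed

end
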